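(* The provably total functions of $\mathbf{PA}+\mathcal K\Sigma^-_1$ and of $\mathbf{PA}$ coincide.
   Context: $\mathbf{PA}$ is first order Peano arithmetic. A formula of first order arithmetic is $\Delta^0_0=\Sigma^0_0=\Pi^0_0$ if all its quantifiers are bounded; a $\Sigma^0_{n+1}$-formula (resp. $\Pi^0_{n+1}$-formula) has the form $\exists_x\varphi$ with $\varphi$ a $\Pi^0_n$-formula (resp. $\forall_x\varphi$ with $\varphi$ a $\Sigma^0_n$-formula). Provably total functions. A computable function $f:\mathbb N\to\mathbb N$ is provably total in a theory $\mathbf T$ in the language of arithmetic if there is a $\Sigma^0_1$-formula $\varphi(x,y)$ that defines the graph of $f$ in the standard model $\mathbb N$ and satisfies $\mathbf T\vdash\forall_x\exists!_y\varphi(x,y)$. Binary trees. $\mathcal B$ is the set of finite binary trees, inductively generated by: $\circ\in\mathcal B$; if $s,t\in\mathcal B$ then $\circ(s,t)\in\mathcal B$. The relation $\leq_{\mathcal B}$ on $\mathcal B$ is defined recursively by: $\circ\leq_{\mathcal B}t$ for every $t$; $s\leq_{\mathcal B}\circ$ only for $s=\circ$; and $\circ(s_0,s_1)\leq_{\mathcal B}\circ(t_0,t_1)$ iff ($s_0\leq_{\mathcal B}t_0$ and $s_1\leq_{\mathcal B}t_1$) or $\circ(s_0,s_1)\leq_{\mathcal B}t_i$ for some $i\in\{0,1\}$. In $\mathbf{PA}$ trees are represented by numerical codes, so that $s\in\mathcal B$ and $s\leq_{\mathcal B}t$ are $\Delta^0_1$-definable in $\mathbf{PA}$. Finite basis scheme.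 For a formula $\varphi(s)$ with a distinguished free variable, $\mathcal K\varphi$ is the formula $\exists_a\big(\text{``}a\text{ codes a finite subset of }\mathcal B\text{''}\land\forall_{s\in a}\varphi(s)\land\forall_{t\in\mathcal B}(\varphi(t)\rightarrow\exists_{s\in a}\,s\leq_{\mathcal B}t)\big)$. The scheme $\mathcal K\Sigma^-_1$ consists of all $\mathcal K\varphi$ where $\varphi$ is a $\Sigma^0_1$-formula with exactly one free variable (no parameters). *)

theory Defs
  imports Complex_Main
begin

section \<open>First-order arithmetic\<close>

text \<open>Formulas over the signature \<open>0, S, +, \<cdot>, <\<close> with de Bruijn indices: a quantifier binds
  index 0 of its body and the remaining free indices are moved up by one.\<close>

datatype tm = Var nat | Zero | Sc tm | Add tm tm | Mul tm tm

datatype fm =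
    Falsum
  | Equal tm tm
  | Less tm tm
  | Imp fm fm
  | Conj fm fm
  | Disj fm fm
  | Forall fm
  | Exists fm

abbreviation Neg :: "fm \<Rightarrow> fm" where
  "Neg \<phi> \<equiv> Imp \<phi> Falsum"

abbreviation Iff :: "fm \<Rightarrow> fm \<Rightarrow> fm" where
  "Iff \<phi> \<psi> \<equiv> Conj (Imp \<phi> \<psi>) (Imp \<psi> \<phi>)"

primrec fv_tm :: "tm \<Rightarrow> nat set" where
  "fv_tm (Var n) = {n}"
| "fv_tm Zero = {}"
| "fv_tm (Sc t) = fv_tm t"
| "fv_tm (Add s t) = fv_tm s \<union> fv_tm t"
| "fv_tm (Mul s t) = fv_tm s \<union> fv_tm t"

primrec fv :: "fm \<Rightarrow> nat set" where
  "fv Falsum = {}"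
| "fv (Equal s t) = fv_tm s \<union> fv_tm t"
| "fv (Less s t) = fv_tm s \<union> fv_tm t"
| "fv (Imp \<phi> \<psi>) = fv \<phi> \<union> fv \<psi>"
| "fv (Conj \<phi> \<psi>) = fv \<phi> \<union> fv \<psi>"
| "fv (Disj \<phi> \<psi>) = fv \<phi> \<union> fv \<psi>"
| "fv (Forall \<phi>) = {n. Suc n \<in> fv \<phi>}"
| "fv (Exists \<phi>) = {n. Suc n \<in> fv \<phi>}"

primrec subst_tm :: "(nat \<Rightarrow> tm) \<Rightarrow> tm \<Rightarrow> tm" where
  "subst_tm \<sigma> (Var n) = \<sigma> n"
| "subst_tm \<sigma> Zero = Zero"
| "subst_tm \<sigma> (Sc t) = Sc (subst_tm \<sigma> t)"
| "subst_tm \<sigma> (Add s t) = Add (subst_tm \<sigma> s) (subst_tm \<sigma> t)"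
| "subst_tm \<sigma> (Mul s t) = Mul (subst_tm \<sigma> s) (subst_tm \<sigma> t)"

definition shift :: "nat \<Rightarrow> tm \<Rightarrow> tm" where
  "shift k = subst_tm (\<lambda>n. Var (n + k))"

definition up :: "(nat \<Rightarrow> tm) \<Rightarrow> nat \<Rightarrow> tm" where
  "up \<sigma> = case_nat (Var 0) (\<lambda>n. shift 1 (\<sigma> n))"

primrec subst :: "(nat \<Rightarrow> tm) \<Rightarrow> fm \<Rightarrow> fm" where
  "subst \<sigma> Falsum = Falsum"
| "subst \<sigma> (Equal s t) = Equal (subst_tm \<sigma> s) (subst_tm \<sigma> t)"
| "subst \<sigma> (Less s t) = Less (subst_tm \<sigma> s) (subst_tm \<sigma> t)"
| "subst \<sigma> (Imp \<phi> \<psi>) = Imp (subst \<sigma> \<phi>) (subst \<sigma> \<psi>)"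
| "subst \<sigma> (Conj \<phi> \<psi>) = Conj (subst \<sigma> \<phi>) (subst \<sigma> \<psi>)"
| "subst \<sigma> (Disj \<phi> \<psi>) = Disj (subst \<sigma> \<phi>) (subst \<sigma> \<psi>)"
| "subst \<sigma> (Forall \<phi>) = Forall (subst (up \<sigma>) \<phi>)"
| "subst \<sigma> (Exists \<phi>) = Exists (subst (up \<sigma>) \<phi>)"

definition lift :: "fm \<Rightarrow> fm" where
  "lift = subst (\<lambda>n. Var (Suc n))"

text \<open>\<open>inst t \<phi>\<close> removes the binding of index 0 and puts \<open>t\<close> in its place.\<close>

definition inst :: "tm \<Rightarrow> fm \<Rightarrow> fm" where
  "inst t = subst (case_nat t Var)"

text \<open>\<open>rename1 \<phi>\<close> is \<open>\<phi>\<close> placed under one additional quantifier whose variable does not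
  occur in it, in such a way that index 0 keeps its role.\<close>

definition rename1 :: "fm \<Rightarrow> fm" where
  "rename1 = subst (case_nat (Var 0) (\<lambda>n. Var (Suc (Suc n))))"


section \<open>Classical natural deduction with equality\<close>

inductive prv :: "fm set \<Rightarrow> fm \<Rightarrow> bool" (infix \<open>\<turnstile>\<close> 50) where
  Assm: "\<phi> \<in> \<Gamma> \<Longrightarrow> \<Gamma> \<turnstile> \<phi>"
| Contr: "insert (Neg \<phi>) \<Gamma> \<turnstile> Falsum \<Longrightarrow> \<Gamma> \<turnstile> \<phi>"
| ImpI: "insert \<phi> \<Gamma> \<turnstile> \<psi> \<Longrightarrow> \<Gamma> \<turnstile> Imp \<phi> \<psi>"
| ImpE: "\<Gamma> \<turnstile> Imp \<phi> \<psi> \<Longrightarrow> \<Gamma> \<turnstile> \<phi> \<Longrightarrow> \<Gamma> \<turnstile> \<psi>"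
| ConjI: "\<Gamma> \<turnstile> \<phi> \<Longrightarrow> \<Gamma> \<turnstile> \<psi> \<Longrightarrow> \<Gamma> \<turnstile> Conj \<phi> \<psi>"
| ConjE1: "\<Gamma> \<turnstile> Conj \<phi> \<psi> \<Longrightarrow> \<Gamma> \<turnstile> \<phi>"
| ConjE2: "\<Gamma> \<turnstile> Conj \<phi> \<psi> \<Longrightarrow> \<Gamma> \<turnstile> \<psi>"
| DisjI1: "\<Gamma> \<turnstile> \<phi> \<Longrightarrow> \<Gamma> \<turnstile> Disj \<phi> \<psi>"
| DisjI2: "\<Gamma> \<turnstile> \<psi> \<Longrightarrow> \<Gamma> \<turnstile> Disj \<phi> \<psi>"
| DisjE: "\<Gamma> \<turnstile> Disj \<phi> \<psi> \<Longrightarrow> insert \<phi> \<Gamma> \<turnstile> \<chi> \<Longrightarrow> insert \<psi> \<Gamma> \<turnstile> \<chi> \<Longrightarrow> \<Gamma> \<turnstile> \<chi>"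
| ForallI: "lift ` \<Gamma> \<turnstile> \<phi> \<Longrightarrow> \<Gamma> \<turnstile> Forall \<phi>"
| ForallE: "\<Gamma> \<turnstile> Forall \<phi> \<Longrightarrow> \<Gamma> \<turnstile> inst t \<phi>"
| ExistsI: "\<Gamma> \<turnstile> inst t \<phi> \<Longrightarrow> \<Gamma> \<turnstile> Exists \<phi>"
| ExistsE: "\<Gamma> \<turnstile> Exists \<phi> \<Longrightarrow> insert \<phi> (lift ` \<Gamma>) \<turnstile> lift \<chi> \<Longrightarrow> \<Gamma> \<turnstile> \<chi>"
| EqRefl: "\<Gamma> \<turnstile> Equal t t"
| EqSubst: "\<Gamma> \<turnstile> Equal s t \<Longrightarrow> \<Gamma> \<turnstile> inst s \<phi> \<Longrightarrow> \<Gamma> \<turnstile> inst t \<phi>"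


section \<open>Peano arithmetic\<close>

definition basic_axioms :: "fm set" where
  "basic_axioms =
    {Forall (Neg (Equal (Sc (Var 0)) Zero)),
     Forall (Forall (Imp (Equal (Sc (Var 1)) (Sc (Var 0))) (Equal (Var 1) (Var 0)))),
     Forall (Equal (Add (Var 0) Zero) (Var 0)),
     Forall (Forall (Equal (Add (Var 1) (Sc (Var 0))) (Sc (Add (Var 1) (Var 0))))),
     Forall (Equal (Mul (Var 0) Zero) Zero),
     Forall (Forall (Equal (Mul (Var 1) (Sc (Var 0))) (Add (Mul (Var 1) (Var 0)) (Var 1)))),
     Forall (Forall (Iff (Less (Var 1) (Var 0))
       (Exists (Equal (Add (Var 2) (Sc (Var 0))) (Var 1)))))}"

text \<open>Induction on index 0; the other free indices are parameters.\<close>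

definition induction_fm :: "fm \<Rightarrow> fm" where
  "induction_fm \<phi> =
    Imp (inst Zero \<phi>)
      (Imp (Forall (Imp \<phi> (subst (case_nat (Sc (Var 0)) (\<lambda>n. Var (Suc n))) \<phi>)))
        (Forall \<phi>))"

text \<open>Parameters are closed off universally: assumptions of a derivation are lifted in
  \<open>ForallI\<close> and \<open>ExistsE\<close>, so that only sentences behave as axioms.\<close>

definition PA :: "fm set" where
  "PA = basic_axioms \<union>
    {(Forall ^^ k) (induction_fm \<phi>) | k \<phi>. fv ((Forall ^^ k) (induction_fm \<phi>)) = {}}"


section \<open>The standard model\<close>

primrec eval_tm :: "(nat \<Rightarrow> nat) \<Rightarrow> tm \<Rightarrow> nat" where
  "eval_tm e (Var n) = e n"
| "eval_tm e Zero = 0"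
| "eval_tm e (Sc t) = Suc (eval_tm e t)"
| "eval_tm e (Add s t) = eval_tm e s + eval_tm e t"
| "eval_tm e (Mul s t) = eval_tm e s * eval_tm e t"

primrec sat :: "(nat \<Rightarrow> nat) \<Rightarrow> fm \<Rightarrow> bool" where
  "sat e Falsum \<longleftrightarrow> False"
| "sat e (Equal s t) \<longleftrightarrow> eval_tm e s = eval_tm e t"
| "sat e (Less s t) \<longleftrightarrow> eval_tm e s < eval_tm e t"
| "sat e (Imp \<phi> \<psi>) \<longleftrightarrow> (sat e \<phi> \<longrightarrow> sat e \<psi>)"
| "sat e (Conj \<phi> \<psi>) \<longleftrightarrow> sat e \<phi> \<and> sat e \<psi>"
| "sat e (Disj \<phi> \<psi>) \<longleftrightarrow> sat e \<phi> \<or> sat e \<psi>"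
| "sat e (Forall \<phi>) \<longleftrightarrow> (\<forall>x. sat (case_nat x e) \<phi>)"
| "sat e (Exists \<phi>) \<longleftrightarrow> (\<exists>x. sat (case_nat x e) \<phi>)"

lemma eval_subst_tm [simp]: "eval_tm e (subst_tm \<sigma> t) = eval_tm (\<lambda>n. eval_tm e (\<sigma> n)) t"
  by (induction t) auto

lemma eval_shift [simp]: "eval_tm e (shift k t) = eval_tm (\<lambda>n. e (n + k)) t"
  by (simp add: shift_def)

lemma eval_up: "(\<lambda>n. eval_tm (case_nat x e) (up \<sigma> n)) = case_nat x (\<lambda>n. eval_tm e (\<sigma> n))"
  by (auto simp: up_def fun_eq_iff split: nat.split)

lemma sat_subst [simp]: "sat e (subst \<sigma> \<phi>) \<longleftrightarrow> sat (\<lambda>n. eval_tm e (\<sigma> n)) \<phi>"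
  by (induction \<phi> arbitrary: e \<sigma>) (auto simp: eval_up)

lemma sat_lift [simp]: "sat (case_nat x e) (lift \<phi>) \<longleftrightarrow> sat e \<phi>"
  by (simp add: lift_def)

lemma sat_inst [simp]: "sat e (inst t \<phi>) \<longleftrightarrow> sat (case_nat (eval_tm e t) e) \<phi>"
proof -
  have "(\<lambda>n. eval_tm e (case_nat t Var n)) = case_nat (eval_tm e t) e"
    by (auto simp: fun_eq_iff split: nat.split)
  then show ?thesis by (simp add: inst_def)
qed

lemma sat_rename1 [simp]:
  "sat (case_nat x (case_nat y e)) (rename1 \<phi>) \<longleftrightarrow> sat (case_nat x e) \<phi>"
proof -
  have "(\<lambda>n. eval_tm (case_nat x (case_nat y e)) (case_nat (Var 0) (\<lambda>n. Var (Suc (Suc n))) n))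
      = case_nat x e"
    by (auto simp: fun_eq_iff split: nat.split)
  then show ?thesis by (simp add: rename1_def)
qed

theorem soundness: "\<Gamma> \<turnstile> \<phi> \<Longrightarrow> \<forall>\<psi>\<in>\<Gamma>. sat e \<psi> \<Longrightarrow> sat e \<phi>"
proof (induction arbitrary: e rule: prv.induct)
  case (ExistsE \<Gamma> \<phi> \<chi>)
  then obtain x where "sat (case_nat x e) \<phi>" by fastforce
  moreover have "\<forall>\<psi>\<in>insert \<phi> (lift ` \<Gamma>). sat (case_nat x e) \<psi>"
    using \<open>sat (case_nat x e) \<phi>\<close> ExistsE.prems by simp
  ultimately have "sat (case_nat x e) (lift \<chi>)" using ExistsE.IH(2) by blast
  then show ?case by simp
next
  case (DisjE \<Gamma> \<phi> \<psi> \<chi>)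
  then have "sat e \<phi> \<or> sat e \<psi>" by simp
  with DisjE show ?case by auto
qed (auto; fail)+

lemma sat_induction_fm: "sat e (induction_fm \<phi>)"
proof -
  have shift_eq: "(\<lambda>n. eval_tm (case_nat x e) (case_nat (Sc (Var 0)) (\<lambda>n. Var (Suc n)) n))
      = case_nat (Suc x) e" for x
    by (auto simp: fun_eq_iff split: nat.split)
  have "sat (case_nat x e) \<phi>"
    if "sat (case_nat 0 e) \<phi>" "\<And>x. sat (case_nat x e) \<phi> \<Longrightarrow> sat (case_nat (Suc x) e) \<phi>" for x
    using that by (induction x) auto
  then show ?thesis by (simp add: induction_fm_def shift_eq)
qed

theorem sat_PA: "\<psi> \<in> PA \<Longrightarrow> sat e \<psi>"
proof -
  have closure: "sat e ((Forall ^^ k) (induction_fm \<phi>))" for k e \<phi>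
    by (induction k arbitrary: e) (auto simp: sat_induction_fm)
  have less: "x < y \<longleftrightarrow> (\<exists>z. Suc (x + z) = y)" for x y :: nat
    by (metis less_iff_Suc_add)
  assume "\<psi> \<in> PA"
  then show ?thesis by (auto simp: PA_def basic_axioms_def closure less)
qed


section \<open>The arithmetical hierarchy\<close>

abbreviation ball_fm :: "tm \<Rightarrow> fm \<Rightarrow> fm" where
  "ball_fm t \<phi> \<equiv> Forall (Imp (Less (Var 0) (shift 1 t)) \<phi>)"

abbreviation bex_fm :: "tm \<Rightarrow> fm \<Rightarrow> fm" where
  "bex_fm t \<phi> \<equiv> Exists (Conj (Less (Var 0) (shift 1 t)) \<phi>)"

inductive is_Delta0 :: "fm \<Rightarrow> bool" where
  "is_Delta0 Falsum"
| "is_Delta0 (Equal s t)"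
| "is_Delta0 (Less s t)"
| "is_Delta0 \<phi> \<Longrightarrow> is_Delta0 \<psi> \<Longrightarrow> is_Delta0 (Imp \<phi> \<psi>)"
| "is_Delta0 \<phi> \<Longrightarrow> is_Delta0 \<psi> \<Longrightarrow> is_Delta0 (Conj \<phi> \<psi>)"
| "is_Delta0 \<phi> \<Longrightarrow> is_Delta0 \<psi> \<Longrightarrow> is_Delta0 (Disj \<phi> \<psi>)"
| "is_Delta0 \<phi> \<Longrightarrow> is_Delta0 (ball_fm t \<phi>)"
| "is_Delta0 \<phi> \<Longrightarrow> is_Delta0 (bex_fm t \<phi>)"

fun is_Sigma :: "nat \<Rightarrow> fm \<Rightarrow> bool" and is_Pi :: "nat \<Rightarrow> fm \<Rightarrow> bool" where
  "is_Sigma 0 \<phi> \<longleftrightarrow> is_Delta0 \<phi>"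
| "is_Sigma (Suc n) \<phi> \<longleftrightarrow> (\<exists>\<psi>. \<phi> = Exists \<psi> \<and> is_Pi n \<psi>)"
| "is_Pi 0 \<phi> \<longleftrightarrow> is_Delta0 \<phi>"
| "is_Pi (Suc n) \<phi> \<longleftrightarrow> (\<exists>\<psi>. \<phi> = Forall \<psi> \<and> is_Sigma n \<psi>)"


section \<open>Provably total functions\<close>

text \<open>Recursive functions as functions on argument lists of the indicated length.  Only total
  functions are generated: minimization is restricted to regular functions.\<close>

inductive recursive_fn :: "nat \<Rightarrow> (nat list \<Rightarrow> nat) \<Rightarrow> bool" where
  "recursive_fn n (\<lambda>xs. 0)"
| "recursive_fn 1 (\<lambda>xs. Suc (hd xs))"
| "i < n \<Longrightarrow> recursive_fn n (\<lambda>xs. xs ! i)"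
| "recursive_fn (length hs) g \<Longrightarrow> (\<And>h. h \<in> set hs \<Longrightarrow> recursive_fn n h) \<Longrightarrow>
    recursive_fn n (\<lambda>xs. g (map (\<lambda>h. h xs) hs))"
| "recursive_fn n g \<Longrightarrow> recursive_fn (n + 2) h \<Longrightarrow>
    recursive_fn (n + 1) (\<lambda>xs. rec_nat (g (tl xs)) (\<lambda>k r. h (k # r # tl xs)) (hd xs))"
| "recursive_fn (n + 1) g \<Longrightarrow> (\<And>xs. length xs = n \<Longrightarrow> \<exists>k. g (k # xs) = 0) \<Longrightarrow>
    recursive_fn n (\<lambda>xs. LEAST k. g (k # xs) = 0)"

definition computable :: "(nat \<Rightarrow> nat) \<Rightarrow> bool" where
  "computable f \<longleftrightarrow> (\<exists>F. recursive_fn 1 F \<and> (\<forall>x. f x = F [x]))"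

text \<open>Unique existence for index 0.\<close>

definition Exists1 :: "fm \<Rightarrow> fm" where
  "Exists1 \<phi> = Exists (Conj \<phi> (Forall (Imp (rename1 \<phi>) (Equal (Var 0) (Var 1)))))"

lemma sat_Exists1: "sat e (Exists1 \<phi>) \<longleftrightarrow> (\<exists>!y. sat (case_nat y e) \<phi>)"
  by (auto simp: Exists1_def)

text \<open>In \<open>\<phi>(x, y)\<close> the variable \<open>x\<close> is index 1 and \<open>y\<close> is index 0.\<close>

definition provably_total :: "fm set \<Rightarrow> (nat \<Rightarrow> nat) \<Rightarrow> bool" where
  "provably_total T f \<longleftrightarrow> computable f \<and>
    (\<exists>\<phi>. is_Sigma 1 \<phi> \<and> fv \<phi> \<subseteq> {0, 1} \<and>
      (\<forall>e. sat e \<phi> \<longleftrightarrow> f (e 1) = e 0) \<and>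
      T \<turnstile> Forall (Exists1 \<phi>))"


section \<open>Binary trees and their arithmetization\<close>

datatype btree = Leaf | Node btree btree

fun btree_le :: "btree \<Rightarrow> btree \<Rightarrow> bool" where
  "btree_le Leaf t \<longleftrightarrow> True"
| "btree_le (Node s0 s1) Leaf \<longleftrightarrow> False"
| "btree_le (Node s0 s1) (Node t0 t1) \<longleftrightarrow>
    (btree_le s0 t0 \<and> btree_le s1 t1) \<or>
    btree_le (Node s0 s1) t0 \<or> btree_le (Node s0 s1) t1"

text \<open>An injective, but not surjective, pairing function that is given by a term.\<close>

definition pair :: "nat \<Rightarrow> nat \<Rightarrow> nat" where
  "pair x y = (x + y) * (x + y) + x"

definition pair_tm :: "tm \<Rightarrow> tm \<Rightarrow> tm" where
  "pair_tm s t = Add (Mul (Add s t) (Add s t)) s"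

primrec code :: "btree \<Rightarrow> nat" where
  "code Leaf = 0"
| "code (Node s t) = Suc (pair (code s) (code t))"

definition node_tm :: "tm \<Rightarrow> tm \<Rightarrow> tm" where
  "node_tm s t = Sc (pair_tm s t)"

text \<open>Finite sets of numbers are coded by divisibility, as in Goedel's beta function:
  \<open>\<langle>n, \<langle>c, d\<rangle>\<rangle>\<close> codes the set of all \<open>x < n\<close> such that \<open>1 + (x + 1) d\<close> divides \<open>c\<close>.
  If \<open>n!\<close> divides \<open>d\<close> these moduli are pairwise coprime, so every finite set has a code.
  A number that is not of the form \<open>\<langle>n, \<langle>c, d\<rangle>\<rangle>\<close> codes the empty set.\<close>

definition decode_set :: "nat \<Rightarrow> nat set" where
  "decode_set a = {x. \<exists>n c d. a = pair n (pair c d) \<and> x < n \<and> Suc (Suc x * d) dvd c}"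

definition mem_fm :: "tm \<Rightarrow> tm \<Rightarrow> fm" where
  "mem_fm x a =
    bex_fm (Sc a) (bex_fm (Sc (shift 1 a)) (bex_fm (Sc (shift 2 a))
      (Conj (Equal (shift 3 a) (pair_tm (Var 2) (pair_tm (Var 1) (Var 0))))
        (Conj (Less (shift 3 x) (Var 2))
          (bex_fm (Sc (Var 1))
            (Equal (Var 2) (Mul (Sc (Mul (Sc (shift 4 x)) (Var 1))) (Var 0))))))))"

text \<open>\<open>t\<close> codes a tree iff it belongs to a finite set each of whose elements is \<open>0\<close> or
  the code of a node with both subtrees in the set.\<close>

definition tree_fm :: "tm \<Rightarrow> fm" where
  "tree_fm t =
    Exists (Conj (mem_fm (shift 1 t) (Var 0))
      (Forall (Imp (mem_fm (Var 0) (Var 1))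
        (Disj (Equal (Var 0) Zero)
          (bex_fm (Var 0) (bex_fm (Var 1)
            (Conj (Equal (Var 2) (node_tm (Var 1) (Var 0)))
              (Conj (mem_fm (Var 1) (Var 3)) (mem_fm (Var 0) (Var 3))))))))))"

text \<open>\<open>w\<close> is a table of the order: it satisfies the recursive clauses for all arguments
  up to \<open>s\<close> and \<open>t\<close>. Under the six quantifiers, indices 5, 4 are the arguments \<open>p \<le> s\<close>,
  \<open>q \<le> t\<close>, while 3, 2 and 1, 0 are their immediate subtrees.\<close>

definition table_fm :: "tm \<Rightarrow> tm \<Rightarrow> tm \<Rightarrow> fm" where
  "table_fm w s t =
    ball_fm (Sc s) (ball_fm (Sc (shift 1 t))
      (Iff (mem_fm (pair_tm (Var 1) (Var 0)) (shift 2 w))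
        (Disj (Equal (Var 1) Zero)
          (bex_fm (Var 1) (bex_fm (Var 2) (bex_fm (Var 2) (bex_fm (Var 3)
            (Conj (Equal (Var 5) (node_tm (Var 3) (Var 2)))
              (Conj (Equal (Var 4) (node_tm (Var 1) (Var 0)))
                (Disj (Conj (mem_fm (pair_tm (Var 3) (Var 1)) (shift 6 w))
                            (mem_fm (pair_tm (Var 2) (Var 0)) (shift 6 w)))
                  (Disj (mem_fm (pair_tm (Var 5) (Var 1)) (shift 6 w))
                        (mem_fm (pair_tm (Var 5) (Var 0)) (shift 6 w)))))))))))))"

text \<open>Tables exist provably in PA and any two of them agree on all arguments up to \<open>s\<close> and
  \<open>t\<close>, so that this is equivalent in PA to the variant with \<open>Exists\<close> and \<open>Conj\<close> in place of
  \<open>Forall\<close> and \<open>Imp\<close>; hence the order is \<open>\<Delta>\<^sub>1\<close> in PA.\<close>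

definition le_fm :: "tm \<Rightarrow> tm \<Rightarrow> fm" where
  "le_fm s t =
    Forall (Imp (table_fm (Var 0) (shift 1 s) (shift 1 t))
      (mem_fm (pair_tm (shift 1 s) (shift 1 t)) (Var 0)))"

definition treeset_fm :: "tm \<Rightarrow> fm" where
  "treeset_fm a = Forall (Imp (mem_fm (Var 0) (shift 1 a)) (tree_fm (Var 0)))"


section \<open>The finite basis scheme\<close>

text \<open>The distinguished variable of \<open>\<phi>\<close> is index 0.\<close>

definition basis_fm :: "fm \<Rightarrow> fm" where
  "basis_fm \<phi> =
    Exists (Conj (treeset_fm (Var 0))
      (Conj (Forall (Imp (mem_fm (Var 0) (Var 1)) (rename1 \<phi>)))
        (Forall (Imp (tree_fm (Var 0)) (Imp (rename1 \<phi>)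
          (Exists (Conj (mem_fm (Var 0) (Var 2)) (le_fm (Var 0) (Var 1)))))))))"

definition K_Sigma1_minus :: "fm set" where
  "K_Sigma1_minus = {basis_fm \<phi> | \<phi>. is_Sigma 1 \<phi> \<and> fv \<phi> = {0}}"


section \<open>Adequacy of the arithmetization in the standard model\<close>

lemma eval_pair_tm [simp]: "eval_tm e (pair_tm s t) = pair (eval_tm e s) (eval_tm e t)"
  by (simp add: pair_tm_def pair_def)

lemma eval_node_tm [simp]: "eval_tm e (node_tm s t) = Suc (pair (eval_tm e s) (eval_tm e t))"
  by (simp add: node_tm_def)

lemma pair_ge1: "x \<le> pair x y"
  by (simp add: pair_def)

lemma pair_ge2: "y \<le> pair x y"
proof -
  have "y \<le> (x + y) * (x + y)"
    by (metis le_add2 le_square order.trans)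
  then show ?thesis by (simp add: pair_def)
qed

lemma pair_sum_mono: "x + y < u + v \<Longrightarrow> pair x y < pair u v"
proof -
  assume "x + y < u + v"
  then have "Suc (x + y) * Suc (x + y) \<le> (u + v) * (u + v)"
    by (intro mult_le_mono) auto
  then show ?thesis by (simp add: pair_def)
qed

lemma pair_inject [simp]: "pair x y = pair u v \<longleftrightarrow> x = u \<and> y = v"
proof
  assume eq: "pair x y = pair u v"
  then have "x + y = u + v"
    by (metis less_irrefl linorder_neqE_nat pair_sum_mono)
  with eq show "x = u \<and> y = v" by (simp add: pair_def)
qed simp

lemma less_Suc_pair: "x < Suc (pair x y)" "y < Suc (pair x y)"
  using pair_ge1 pair_ge2 by (auto simp: less_Suc_eq_le)

lemma node_bound:
  "(\<exists>p<u. \<exists>q<u. u = Suc (pair p q) \<and> R p q) \<longleftrightarrow> (\<exists>p q. u = Suc (pair p q) \<and> R p q)"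
 (is "?L \<longleftrightarrow> ?R")
proof
  assume ?R
  then obtain p q where eq: "u = Suc (pair p q)" and R: "R p q" by blast
  have "p < u" "q < u" unfolding eq by (rule less_Suc_pair)+
  with eq R show ?L by blast
qed blast

lemma node_bound2:
  "(\<exists>p0<p. \<exists>p1<p. \<exists>q0<q. \<exists>q1<q. p = Suc (pair p0 p1) \<and> q = Suc (pair q0 q1) \<and> R p0 p1 q0 q1) \<longleftrightarrow>
   (\<exists>p0 p1 q0 q1. p = Suc (pair p0 p1) \<and> q = Suc (pair q0 q1) \<and> R p0 p1 q0 q1)" (is "?L \<longleftrightarrow> ?R")
proof
  assume ?R
  then obtain p0 p1 q0 q1 where eqs: "p = Suc (pair p0 p1)" "q = Suc (pair q0 q1)"
    and R: "R p0 p1 q0 q1" by blast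
  have "p0 < p" "p1 < p" "q0 < q" "q1 < q" unfolding eqs by (rule less_Suc_pair)+
  with eqs R show ?L by blast
qed blast

lemma code_inject [simp]: "code s = code t \<longleftrightarrow> s = t"
proof (induction s arbitrary: t)
  case Leaf
  then show ?case by (cases t) auto
next
  case (Node s1 s2)
  then show ?case by (cases t) auto
qed

lemma sat_mem_fm [simp]: "sat e (mem_fm x a) \<longleftrightarrow> eval_tm e x \<in> decode_set (eval_tm e a)"
proof -
  let ?x = "eval_tm e x" and ?a = "eval_tm e a"
  have "sat e (mem_fm x a) \<longleftrightarrow>
      (\<exists>n<Suc ?a. \<exists>c<Suc ?a. \<exists>d<Suc ?a. ?a = pair n (pair c d) \<and> ?x < n \<and>
        (\<exists>q<Suc c. c = Suc (Suc ?x * d) * q))"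
    by (simp add: mem_fm_def eval_nat_numeral)
  also have "\<dots> \<longleftrightarrow> (\<exists>n c d. ?a = pair n (pair c d) \<and> ?x < n \<and> Suc (Suc ?x * d) dvd c)"
    (is "?L \<longleftrightarrow> ?R")
  proof
    assume ?L
    then show ?R by (metis dvd_triv_left)
  next
    assume ?R
    then obtain n c d where ncd: "?a = pair n (pair c d)" "?x < n" "Suc (Suc ?x * d) dvd c" by blast
    then obtain q where q: "c = Suc (Suc ?x * d) * q" by (elim dvdE)
    then have "q < Suc c" by simp
    moreover have "n < Suc ?a" "c < Suc ?a" "d < Suc ?a"
      unfolding ncd by (meson le_imp_less_Suc order.trans pair_ge1 pair_ge2)+
    ultimately show ?L using ncd(1,2) q by blast
  qed
  finally show ?thesis by (simp add: decode_set_def)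
qed

lemma finite_decode_set: "finite (decode_set a)"
proof (rule finite_subset)
  show "decode_set a \<subseteq> {..a}"
  proof
    fix x assume "x \<in> decode_set a"
    then obtain n m where "a = pair n m" "x < n" unfolding decode_set_def by blast
    then show "x \<in> {..a}" using pair_ge1[of n m] by simp
  qed
qed simp

lemma decode_set_surj:
  assumes "finite X"
  obtains a where "decode_set a = X"
proof -
  obtain n where n: "X \<subseteq> {..<n}"
    using assms unfolding finite_nat_set_iff_bounded by blast
  define d where "d = (fact n :: nat)"
  define m where "m x = Suc (Suc x * d)" for x
  define c where "c = prod m X"
  have coprime_aux: "coprime (m x) (m y)" if "x < y" "y < n" for x y
  proof (rule coprimeI)
    fix g assume g: "g dvd m x" "g dvd m y"
    have "coprime g d"
    proof (rule coprimeI)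
      fix h assume h: "h dvd g" "h dvd d"
      then have "h dvd Suc (Suc x * d)" "h dvd Suc x * d"
        using g(1) dvd_trans m_def by auto
      then show "is_unit h" by (metis Suc_eq_plus1 dvd_add_right_iff)
    qed
    moreover have "g dvd m y - m x" using g by (rule dvd_diff_nat[rotated])
    moreover have "m y - m x = (y - x) * d" by (simp add: m_def diff_mult_distrib)
    ultimately have "g dvd y - x" by (simp add: coprime_dvd_mult_left_iff)
    moreover have "y - x dvd d" using that by (auto simp: d_def intro!: dvd_fact)
    ultimately have "g dvd d" by (rule dvd_trans)
    with \<open>coprime g d\<close> show "is_unit g" by (meson coprime_common_divisor dvd_refl)
  qed
  have coprime_m: "coprime (m x) (m y)" if "x \<noteq> y" "x < n" "y < n" for x y
    using that coprime_aux coprime_commute by (meson linorder_neqE_nat)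
  have "m x dvd c \<longleftrightarrow> x \<in> X" if "x < n" for x
  proof
    assume "m x dvd c"
    show "x \<in> X"
    proof (rule ccontr)
      assume "x \<notin> X"
      then have "coprime (m x) c"
        unfolding c_def using n that by (intro prod_coprime_right coprime_m) auto
      with \<open>m x dvd c\<close> have "m x = 1"
        by (metis coprime_common_divisor dvd_refl nat_dvd_1_iff_1)
      then show False by (simp add: m_def d_def)
    qed
  next
    assume "x \<in> X"
    then show "m x dvd c" unfolding c_def using assms by (simp add: dvd_prodI)
  qed
  then have "decode_set (pair n (pair c d)) = X"
    using n by (auto simp: decode_set_def m_def)
  then show ?thesis by (rule that)
qed

fun subtrees :: "btree \<Rightarrow> btree set" where
  "subtrees Leaf = {Leaf}"
| "subtrees (Node s t) = insert (Node s t) (subtrees s \<union> subtrees t)"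

lemma finite_subtrees: "finite (subtrees t)"
  by (induction t) auto

lemma self_subtree: "t \<in> subtrees t"
  by (cases t) auto

lemma node_subtrees: "Node u v \<in> subtrees t \<Longrightarrow> u \<in> subtrees t \<and> v \<in> subtrees t"
  by (induction t) (auto simp: self_subtree)

theorem sat_tree_fm [simp]: "sat e (tree_fm t) \<longleftrightarrow> eval_tm e t \<in> range code"
proof -
  let ?closed = "\<lambda>W. \<forall>u\<in>W. u = 0 \<or> (\<exists>p\<in>W. \<exists>q\<in>W. u = Suc (pair p q))"
  have "sat e (tree_fm t) \<longleftrightarrow> (\<exists>w. eval_tm e t \<in> decode_set w \<and> ?closed (decode_set w))"
    by (simp add: tree_fm_def eval_nat_numeral node_bound Ball_def Bex_def) (meson)
  also have "\<dots> \<longleftrightarrow> eval_tm e t \<in> range code"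
  proof
    assume "\<exists>w. eval_tm e t \<in> decode_set w \<and> ?closed (decode_set w)"
    then obtain w where w: "eval_tm e t \<in> decode_set w" "?closed (decode_set w)" by blast
    have "u \<in> range code" if "u \<in> decode_set w" for u
      using that
    proof (induction u rule: less_induct)
      case (less u)
      show ?case
      proof (cases "u = 0")
        case True
        then have "u = code Leaf" by simp
        then show ?thesis by (rule range_eqI)
      next
        case False
        with less.prems w(2) obtain p q
          where pq: "p \<in> decode_set w" "q \<in> decode_set w" "u = Suc (pair p q)"
          by meson
        then have "p \<in> range code" "q \<in> range code"
          by (simp_all only: less.IH less_Suc_pair)
        then obtain p' q' where "p = code p'" "q = code q'" by (elim imageE)
        with pq have "u = code (Node p' q')" by simp
        then show ?thesis by (rule range_eqI)
      qed
    qed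
    with w(1) show "eval_tm e t \<in> range code" by blast
  next
    assume "eval_tm e t \<in> range code"
    then obtain t' where t': "eval_tm e t = code t'" by blast
    obtain w where w: "decode_set w = code ` subtrees t'"
      using decode_set_surj[OF finite_imageI[OF finite_subtrees]] by blast
    have "?closed (code ` subtrees t')"
    proof
      fix u assume "u \<in> code ` subtrees t'"
      then obtain s where s: "s \<in> subtrees t'" "u = code s" by blast
      show "u = 0 \<or> (\<exists>p\<in>code ` subtrees t'. \<exists>q\<in>code ` subtrees t'. u = Suc (pair p q))"
      proof (cases s)
        case (Node p q)
        then have "code p \<in> code ` subtrees t'" "code q \<in> code ` subtrees t'"
          using s(1) node_subtrees by (meson imageI)+
        then show ?thesis using s(2) Node code.simps(2) by blast
      qed (simp add: s(2))
    qed
    then show "\<exists>w. eval_tm e t \<in> decode_set w \<and> ?closed (decode_set w)"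
      using t' w self_subtree by (intro exI[of _ w]) auto
  qed
  finally show ?thesis .
qed

text \<open>The relation that the clauses of \<open>table_fm\<close> define on all numbers.\<close>

inductive num_le :: "nat \<Rightarrow> nat \<Rightarrow> bool" where
  "num_le 0 q"
| "num_le p0 q0 \<Longrightarrow> num_le p1 q1 \<Longrightarrow> num_le (Suc (pair p0 p1)) (Suc (pair q0 q1))"
| "num_le (Suc (pair p0 p1)) q0 \<Longrightarrow> num_le (Suc (pair p0 p1)) (Suc (pair q0 q1))"
| "num_le (Suc (pair p0 p1)) q1 \<Longrightarrow> num_le (Suc (pair p0 p1)) (Suc (pair q0 q1))"

definition is_table :: "nat set \<Rightarrow> nat \<Rightarrow> nat \<Rightarrow> bool" where
  "is_table W s t \<longleftrightarrow> (\<forall>p\<le>s. \<forall>q\<le>t. pair p q \<in> W \<longleftrightarrow> p = 0 \<or>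
    (\<exists>p0 p1 q0 q1. p = Suc (pair p0 p1) \<and> q = Suc (pair q0 q1) \<and>
      (pair p0 q0 \<in> W \<and> pair p1 q1 \<in> W \<or> pair p q0 \<in> W \<or> pair p q1 \<in> W)))"

lemma sat_table_fm [simp]:
  "sat e (table_fm w s t) \<longleftrightarrow> is_table (decode_set (eval_tm e w)) (eval_tm e s) (eval_tm e t)"
proof -
  have "sat e (table_fm w s t) \<longleftrightarrow>
    (\<forall>p<Suc (eval_tm e s). \<forall>q<Suc (eval_tm e t).
      pair p q \<in> decode_set (eval_tm e w) \<longleftrightarrow> p = 0 \<or>
      (\<exists>p0<p. \<exists>p1<p. \<exists>q0<q. \<exists>q1<q. p = Suc (pair p0 p1) \<and> q = Suc (pair q0 q1) \<and>
        (pair p0 q0 \<in> decode_set (eval_tm e w) \<and> pair p1 q1 \<in> decode_set (eval_tm e w) \<or>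
         pair p q0 \<in> decode_set (eval_tm e w) \<or> pair p q1 \<in> decode_set (eval_tm e w))))"
    by (simp add: table_fm_def eval_nat_numeral del: imp_disjL)
      (intro all_cong1 imp_cong refl, rule iff_conv_conj_imp[symmetric])
  then show ?thesis unfolding node_bound2 is_table_def by (simp add: less_Suc_eq_le)
qed

lemma table_exists: obtains w where "is_table (decode_set w) s t"
proof -
  let ?W = "(\<lambda>(p, q). pair p q) ` {(p, q). p \<le> s \<and> q \<le> t \<and> num_le p q}"
  have "finite ?W"
  proof (rule finite_imageI, rule finite_subset)
    show "{(p, q). p \<le> s \<and> q \<le> t \<and> num_le p q} \<subseteq> {..s} \<times> {..t}" by auto
  qed simp
  then obtain w where w: "decode_set w = ?W" by (rule decode_set_surj)
  have mem: "pair p q \<in> ?W \<longleftrightarrow> p \<le> s \<and> q \<le> t \<and> num_le p q" for p q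
    by (auto simp: image_iff)
  have "is_table ?W s t"
    unfolding is_table_def mem
  proof (intro allI impI)
    fix p q assume pq: "p \<le> s" "q \<le> t"
    have bounds: "p0 \<le> s \<and> p1 \<le> s" if "p = Suc (pair p0 p1)" for p0 p1
      using pq that pair_ge1[of p0 p1] pair_ge2[of p1 p0] by simp
    have bounds': "q0 \<le> t \<and> q1 \<le> t" if "q = Suc (pair q0 q1)" for q0 q1
      using pq that pair_ge1[of q0 q1] pair_ge2[of q1 q0] by simp
    show "(p \<le> s \<and> q \<le> t \<and> num_le p q) \<longleftrightarrow> p = 0 \<or>
      (\<exists>p0 p1 q0 q1. p = Suc (pair p0 p1) \<and> q = Suc (pair q0 q1) \<and>
        ((p0 \<le> s \<and> q0 \<le> t \<and> num_le p0 q0) \<and> (p1 \<le> s \<and> q1 \<le> t \<and> num_le p1 q1) \<or>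
         (p \<le> s \<and> q0 \<le> t \<and> num_le p q0) \<or> (p \<le> s \<and> q1 \<le> t \<and> num_le p q1)))"
      using pq bounds bounds' by (subst num_le.simps) blast
  qed
  with w show ?thesis by (metis that)
qed

lemma table_correct:
  assumes "is_table W a b" "code s \<le> a" "code t \<le> b"
  shows "pair (code s) (code t) \<in> W \<longleftrightarrow> btree_le s t"
  using assms(2,3)
proof (induction s t rule: btree_le.induct)
  case (1 t)
  with assms(1) show ?case unfolding is_table_def by auto
next
  case (2 s0 s1)
  with assms(1) show ?case unfolding is_table_def by auto
next
  case (3 s0 s1 t0 t1)
  have "code s0 \<le> a" "code s1 \<le> a" "code t0 \<le> b" "code t1 \<le> b"
    using 3(5,6) pair_ge1[of "code s0" "code s1"] pair_ge2[of "code s1" "code s0"]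
      pair_ge1[of "code t0" "code t1"] pair_ge2[of "code t1" "code t0"] by auto
  moreover have "pair (code (Node s0 s1)) (code (Node t0 t1)) \<in> W \<longleftrightarrow>
    pair (code s0) (code t0) \<in> W \<and> pair (code s1) (code t1) \<in> W \<or>
    pair (code (Node s0 s1)) (code t0) \<in> W \<or> pair (code (Node s0 s1)) (code t1) \<in> W"
    using assms(1) 3(5,6) unfolding is_table_def by simp
  ultimately show ?case using 3 by simp
qed

theorem sat_le_fm:
  assumes "eval_tm e x = code s" "eval_tm e y = code t"
  shows "sat e (le_fm x y) \<longleftrightarrow> btree_le s t"
proof -
  have "sat e (le_fm x y) \<longleftrightarrow>
      (\<forall>w. is_table (decode_set w) (code s) (code t) \<longrightarrow> pair (code s) (code t) \<in> decode_set w)"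
    using assms by (simp add: le_fm_def)
  then show ?thesis by (metis order.refl table_correct table_exists)
qed

lemma sat_treeset_fm [simp]: "sat e (treeset_fm a) \<longleftrightarrow> decode_set (eval_tm e a) \<subseteq> range code"
  by (auto simp: treeset_fm_def)

theorem sat_basis_fm:
  "sat e (basis_fm \<phi>) \<longleftrightarrow>
    (\<exists>A. finite A \<and> (\<forall>s\<in>A. sat (case_nat (code s) e) \<phi>) \<and>
      (\<forall>t. sat (case_nat (code t) e) \<phi> \<longrightarrow> (\<exists>s\<in>A. btree_le s t)))"
proof -
  let ?P = "\<lambda>A. (\<forall>s\<in>A. sat (case_nat (code s) e) \<phi>) \<and>
      (\<forall>t. sat (case_nat (code t) e) \<phi> \<longrightarrow> (\<exists>s\<in>A. btree_le s t))"
  have body: "sat e (basis_fm \<phi>) \<longleftrightarrow>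
      (\<exists>a. decode_set a \<subseteq> range code \<and>
        (\<forall>x\<in>decode_set a. sat (case_nat x e) \<phi>) \<and>
        (\<forall>y\<in>range code. sat (case_nat y e) \<phi> \<longrightarrow>
          (\<exists>x\<in>decode_set a. sat (case_nat x (case_nat y (case_nat a e))) (le_fm (Var 0) (Var 1)))))"
    by (simp add: basis_fm_def eval_nat_numeral Ball_def Bex_def)
  have le: "sat (case_nat (code s) (case_nat (code t) e')) (le_fm (Var 0) (Var 1)) \<longleftrightarrow> btree_le s t"
    for s t e'
    by (rule sat_le_fm) auto
  show ?thesis
  proof
    assume "sat e (basis_fm \<phi>)"
    then obtain a where a: "decode_set a \<subseteq> range code"
        "\<forall>x\<in>decode_set a. sat (case_nat x e) \<phi>"
        "\<forall>y\<in>range code. sat (case_nat y e) \<phi> \<longrightarrow>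
          (\<exists>x\<in>decode_set a. sat (case_nat x (case_nat y (case_nat a e))) (le_fm (Var 0) (Var 1)))"
      using body by blast
    then obtain A where A: "decode_set a = code ` A" by (meson subset_imageE)
    have "inj_on code A" by (auto intro: inj_onI)
    then have "finite A" using A finite_decode_set by (metis finite_imageD)
    moreover have "?P A" using a(2,3) unfolding A by (simp add: le[simplified])
    ultimately show "\<exists>A. finite A \<and> ?P A" by blast
  next
    assume "\<exists>A. finite A \<and> ?P A"
    then obtain A where A: "finite A" "?P A" by blast
    obtain a where "decode_set a = code ` A"
      using decode_set_surj[OF finite_imageI[OF A(1)]] by blast
    with A(2) show "sat e (basis_fm \<phi>)"
      unfolding body by (intro exI[of _ a]) (auto simp: le[simplified])
  qed
qed

end

(* By Kruskal's theorem an instance of the scheme holds in the standard model with a concrete finite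
   basis a.  That a is a basis follows in pure logic from true Pi_1 sentences: the only existential
   information needed (trees in a being trees, and satisfying the formula) is provided by numerals,
   and the order relation is used only with a universal quantifier.  So in any structure in which the
   instance fails a false Sigma_1 sentence nu is true.

   If PA with the scheme proves that phi(x, y) defines a total function, then PA proves that for every
   x there is a y with phi(x, y) or nu.  Bounding the existential quantifiers of this disjunction by b
   gives a bounded formula beta(b, x, y); taking first the least b that works for some y < b and then
   the least y makes the relation single-valued provably in PA, by the least number principle, and in
   the standard model it still defines the graph because nu is false.  Provability in PA is handled
   through completeness, so that only semantic arguments in models of PA are needed. *)
theory Submission
  imports Defs "HOL-Library.Ramsey" "HOL-Library.Countable_Set"
begin

section \<open>Kruskal's theorem for binary trees\<close>

definition bad :: "(nat \<Rightarrow> btree) \<Rightarrow> bool" where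
  "bad f \<longleftrightarrow> (\<forall>i j. i < j \<longrightarrow> \<not> btree_le (f i) (f j))"

lemma btree_le_Node: "s \<noteq> Leaf \<Longrightarrow> btree_le s u \<or> btree_le s v \<Longrightarrow> btree_le s (Node u v)"
  by (cases s) auto

lemma bad_not_Leaf: "bad f \<Longrightarrow> f i \<noteq> Leaf"
  unfolding bad_def by (metis btree_le.simps(1) lessI)

text \<open>The minimal bad sequence of Nash-Williams: stage \<open>n\<close> keeps the first
  \<open>n\<close> terms and makes the term at \<open>n\<close> as small as some bad continuation
  allows.\<close>

lemma minimal_bad:
  assumes "bad f"
  obtains m where "bad m"
    "\<And>n g. (\<And>i. i < n \<Longrightarrow> g i = m i) \<Longrightarrow> size (g n) < size (m n) \<Longrightarrow> \<not> bad g"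
proof -
  define step where "step n g = (ARG_MIN (\<lambda>h. size (h n)) h. bad h \<and> (\<forall>i<n. h i = g i))"
    for n and g :: "nat \<Rightarrow> btree"
  define F where "F = rec_nat f step"
  have F_Suc: "F (Suc n) = step n (F n)" for n by (simp add: F_def)
  have step: "bad (step n g) \<and> (\<forall>i<n. step n g i = g i) \<and>
      (\<forall>h. bad h \<and> (\<forall>i<n. h i = g i) \<longrightarrow> size (step n g n) \<le> size (h n))" if "bad g" for n g
    unfolding step_def using that
      arg_min_nat_lemma[of "\<lambda>h. bad h \<and> (\<forall>i<n. h i = g i)" g "\<lambda>h. size (h n)"] by simp
  have badF: "bad (F n)" for n
  proof (induction n)
    case 0
    show ?case using assms by (simp add: F_def)
  next
    case (Suc n)
    then show ?case using step F_Suc by auto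
  qed
  \<comment> \<open>Stages after \<open>Suc i\<close> no longer touch position \<open>i\<close>, so
    the diagonal sequence agrees with each stage on an initial segment. Badness and minimality pass
    to it in this way.\<close>
  have stable: "F k i = F (Suc i) i" if "i < k" for i k
    using that
  proof (induction k)
    case (Suc k)
    then show ?case
      using step[OF badF[of k], of k] F_Suc[of k] by (cases "i = k") auto
  qed simp
  define m where "m i = F (Suc i) i" for i
  have "bad m"
    unfolding bad_def
  proof (intro allI impI)
    fix i j :: nat assume "i < j"
    then have "m i = F (Suc j) i" "m j = F (Suc j) j" using stable[of i "Suc j"] by (auto simp: m_def)
    then show "\<not> btree_le (m i) (m j)" using badF[of "Suc j"] \<open>i < j\<close> by (simp add: bad_def)
  qed
  moreover have "\<not> bad g" if "\<And>i. i < n \<Longrightarrow> g i = m i" "size (g n) < size (m n)" for n g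
  proof
    assume "bad g"
    moreover have "g i = F n i" if "i < n" for i
      using \<open>\<And>i. i < n \<Longrightarrow> g i = m i\<close>[OF that] stable[OF that] by (simp add: m_def)
    ultimately have "size (step n (F n) n) \<le> size (g n)"
      using step[OF badF, THEN conjunct2, THEN conjunct2, rule_format, of g n n] by simp
    then show False using that(2) by (simp add: m_def F_Suc)
  qed
  ultimately show thesis by (rule that)
qed

text \<open>The immediate subtrees of a minimal bad sequence admit no bad sequence. Ramsey's theorem
  then yields a subsequence whose left subtrees increase; two right subtrees along it compare, and
  so do the corresponding terms.\<close>

theorem Kruskal: "\<not> bad f"
proof
  assume "bad f"
  then obtain m where m: "bad m"
    and min: "\<And>n g. (\<And>i. i < n \<Longrightarrow> g i = m i) \<Longrightarrow> size (g n) < size (m n) \<Longrightarrow> \<not> bad g"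
    by (rule minimal_bad) blast
  have "\<exists>u v. m n = Node u v" for n using bad_not_Leaf[OF m, of n] by (cases "m n") auto
  then obtain l r where lr: "\<And>n. m n = Node (l n) (r n)" by metis
  define child where "child k t \<longleftrightarrow> t = l k \<or> t = r k" for k t
  have child: "child k t \<Longrightarrow> size t < size (m k) \<and> (\<forall>i. btree_le (m i) t \<longrightarrow> btree_le (m i) (m k))"
    for k t using bad_not_Leaf[OF m] by (auto simp: child_def lr btree_le_Node simp del: btree_le.simps)
  have children: "\<not> bad g" if g: "\<And>i. child (k i) (g i)" for g k
  proof
    assume "bad g"
    \<comment> \<open>The parent indices \<open>k i\<close> may repeat or drop, so the splice starts
      at a position whose parent index is least. All of \<open>m\<close> before that index is kept,
      and every child has its parent at or beyond it.\<close>
    obtain p where p: "\<And>i. k p \<le> k i" using ex_has_least_nat[of "\<lambda>_. True" _ k] by blast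
    define h where "h i = (if i < k p then m i else g (p + (i - k p)))" for i
    have "bad h"
      unfolding bad_def
    proof (intro allI impI notI)
      fix i j :: nat assume ij: "i < j" "btree_le (h i) (h j)"
      show False
      proof (cases "j < k p")
        case True
        then show False using ij m by (simp add: h_def bad_def)
      next
        case False
        let ?q = "p + (j - k p)"
        show False
        proof (cases "i < k p")
          case True
          \<comment> \<open>A term below a child is below the child's parent, which stands after
            position \<open>i\<close>.\<close>
          then have "btree_le (m i) (m (k ?q))" using child[OF g[of ?q]] ij False by (auto simp: h_def)
          moreover have "i < k ?q" using True p[of ?q] by simp
          ultimately show False using m by (simp add: bad_def)
        next
          case i: False
          then have "p + (i - k p) < ?q" using False ij(1) by simp
          then show False using \<open>bad g\<close> ij False i by (auto simp: h_def bad_def)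
        qed
      qed
    qed
    moreover have "\<not> bad h"
      by (rule min[of "k p"]) (use child[OF g[of p]] in \<open>auto simp: h_def\<close>)
    ultimately show False by blast
  qed
  \<comment> \<open>Ramsey's theorem colours unordered pairs; \<open>Min\<close> and
    \<open>Max\<close> restore the order of the two indices.\<close>
  define c where "c X = (if btree_le (l (Min X)) (l (Max X)) then 1 else 0::nat)" for X
  obtain Y t where Y: "infinite Y" and t: "\<And>x y. x \<in> Y \<Longrightarrow> y \<in> Y \<Longrightarrow> x \<noteq> y \<Longrightarrow> c {x, y} = t"
  proof -
    have "\<forall>x\<in>UNIV. \<forall>y\<in>UNIV. x \<noteq> y \<longrightarrow> c {x, y} < 2" by (simp add: c_def)
    from Ramsey2[OF infinite_UNIV_nat this] show thesis using that by metis
  qed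
  let ?e = "enumerate Y"
  have e: "?e i < ?e j" if "i < j" for i j using Y that by simp
  have ct: "c {?e i, ?e j} = t" if "i < j" for i j
    using t[OF enumerate_in_set[OF Y] enumerate_in_set[OF Y]] e[OF that] by (metis less_irrefl)
  have cij: "c {?e i, ?e j} = (if btree_le (l (?e i)) (l (?e j)) then 1 else 0)" if "i < j" for i j
    using e[OF that] by (simp add: c_def)
  \<comment> \<open>One comparable pair of left subtrees excludes colour 0, so by homogeneity all
    pairs compare.\<close>
  have "\<not> bad (\<lambda>i. l (?e i))" by (rule children[of ?e]) (simp add: child_def)
  then obtain i j where "i < j" "btree_le (l (?e i)) (l (?e j))" by (auto simp: bad_def)
  then have "t = 1" using cij ct by metis
  then have l: "btree_le (l (?e i)) (l (?e j))" if "i < j" for i j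
    using ct[OF that] cij[OF that] by (metis zero_neq_one)
  have "\<not> bad (\<lambda>i. r (?e i))" by (rule children[of ?e]) (simp add: child_def)
  then obtain i j where "i < j" "btree_le (r (?e i)) (r (?e j))" by (auto simp: bad_def)
  then have "btree_le (m (?e i)) (m (?e j))" using l by (simp add: lr)
  then show False using m e[OF \<open>i < j\<close>] by (auto simp: bad_def)
qed

text \<open>Otherwise every finite subset of \<open>X\<close> leaves some element of
  \<open>X\<close> that is above none of its members, and collecting such elements one after the
  other gives a bad sequence.\<close>

corollary finite_basis: "\<exists>A\<subseteq>X. finite A \<and> (\<forall>t\<in>X. \<exists>s\<in>A. btree_le s t)"
proof (rule ccontr)
  assume "\<not> ?thesis"
  then have *: "\<exists>t. t \<in> X \<and> (\<forall>s\<in>A. \<not> btree_le s t)" if "finite A" "A \<subseteq> X" for A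
    using that by meson
  define new where "new A = (SOME t. t \<in> X \<and> (\<forall>s\<in>A. \<not> btree_le s t))" for A
  define A where "A = rec_nat {} (\<lambda>_ B. insert (new B) B)"
  have A_Suc: "A (Suc n) = insert (new (A n)) (A n)" for n by (simp add: A_def)
  have new: "new B \<in> X \<and> (\<forall>s\<in>B. \<not> btree_le s (new B))" if "finite B" "B \<subseteq> X" for B
    unfolding new_def by (rule someI_ex[OF *[OF that]])
  have A: "finite (A n) \<and> A n \<subseteq> X" for n
    by (induction n) (simp_all add: A_Suc new, simp_all add: A_def)
  have in_A: "new (A i) \<in> A j" if "i < j" for i j
    using that by (induction j) (auto simp: A_Suc less_Suc_eq)
  have "bad (\<lambda>n. new (A n))" unfolding bad_def
  proof (intro allI impI)
    fix i j :: nat assume "i < j"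
    then show "\<not> btree_le (new (A i)) (new (A j))" using in_A new[of "A j"] A[of j] by simp
  qed
  then show False using Kruskal by blast
qed


section \<open>Substitution\<close>

lemma subst_tm_subst_tm: "subst_tm \<sigma> (subst_tm \<tau> t) = subst_tm (\<lambda>n. subst_tm \<sigma> (\<tau> n)) t"
  by (induction t) auto

lemma subst_tm_Var [simp]: "subst_tm Var t = t"
  by (induction t) auto

lemma up_simps [simp]: "up \<sigma> 0 = Var 0" "up \<sigma> (Suc n) = shift 1 (\<sigma> n)"
  by (simp_all add: up_def)

lemma up_comp: "(\<lambda>n. subst_tm (up \<sigma>) (up \<tau> n)) = up (\<lambda>n. subst_tm \<sigma> (\<tau> n))"
  by (auto simp: fun_eq_iff up_def shift_def subst_tm_subst_tm split: nat.split)

lemma subst_subst: "subst \<sigma> (subst \<tau> \<phi>) = subst (\<lambda>n. subst_tm \<sigma> (\<tau> n)) \<phi>"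
  by (induction \<phi> arbitrary: \<sigma> \<tau>) (auto simp: subst_tm_subst_tm up_comp)

lemma up_Var: "up Var = Var"
  by (auto simp: fun_eq_iff up_def shift_def split: nat.split)

lemma subst_Var [simp]: "subst Var \<phi> = \<phi>"
  by (induction \<phi>) (auto simp: up_Var)

lemma subst_tm_cong: "(\<And>n. n \<in> fv_tm t \<Longrightarrow> \<sigma> n = \<tau> n) \<Longrightarrow> subst_tm \<sigma> t = subst_tm \<tau> t"
  by (induction t) auto

lemma subst_fv_cong: "(\<And>n. n \<in> fv \<phi> \<Longrightarrow> \<sigma> n = \<tau> n) \<Longrightarrow> subst \<sigma> \<phi> = subst \<tau> \<phi>"
proof (induction \<phi> arbitrary: \<sigma> \<tau>)
  case (Equal s t)
  then show ?case using subst_tm_cong by (metis UnCI fv.simps(2) subst.simps(2))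
next
  case (Less s t)
  then show ?case using subst_tm_cong by (metis UnCI fv.simps(3) subst.simps(3))
next
  case (Imp \<phi> \<psi>)
  then show ?case by (metis UnCI fv.simps(4) subst.simps(4))
next
  case (Conj \<phi> \<psi>)
  then show ?case by (metis UnCI fv.simps(5) subst.simps(5))
next
  case (Disj \<phi> \<psi>)
  then show ?case by (metis UnCI fv.simps(6) subst.simps(6))
next
  case (Forall \<phi>)
  have "up \<sigma> n = up \<tau> n" if "n \<in> fv \<phi>" for n using that Forall.prems by (cases n) auto
  then show ?case using Forall.IH[of "up \<sigma>" "up \<tau>"] by simp
next
  case (Exists \<phi>)
  have "up \<sigma> n = up \<tau> n" if "n \<in> fv \<phi>" for n using that Exists.prems by (cases n) auto
  then show ?case using Exists.IH[of "up \<sigma>" "up \<tau>"] by simp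
qed simp

lemma subst_closed: "fv \<phi> = {} \<Longrightarrow> subst \<sigma> \<phi> = \<phi>"
  using subst_fv_cong[of \<phi> \<sigma> Var] by simp

lemma fv_tm_subst_tm: "fv_tm (subst_tm \<sigma> t) = (\<Union>n\<in>fv_tm t. fv_tm (\<sigma> n))"
  by (induction t) auto

lemma fv_tm_shift: "fv_tm (shift k t) = (\<lambda>n. n + k) ` fv_tm t"
  by (auto simp: shift_def fv_tm_subst_tm)

lemma fv_up: "{n. Suc n \<in> (\<Union>k\<in>A. fv_tm (up \<sigma> k))} = (\<Union>k\<in>{n. Suc n \<in> A}. fv_tm (\<sigma> k))"
proof -
  have "Suc n \<in> fv_tm (up \<sigma> k) \<longleftrightarrow> (\<exists>m. k = Suc m \<and> n \<in> fv_tm (\<sigma> m))" for n k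
    by (cases k) (auto simp: fv_tm_shift)
  then show ?thesis by fastforce
qed

lemma fv_subst: "fv (subst \<sigma> \<phi>) = (\<Union>n\<in>fv \<phi>. fv_tm (\<sigma> n))"
proof (induction \<phi> arbitrary: \<sigma>)
  case (Forall \<phi>)
  show ?case unfolding subst.simps fv.simps Forall.IH by (rule fv_up)
next
  case (Exists \<phi>)
  show ?case unfolding subst.simps fv.simps Exists.IH by (rule fv_up)
qed (auto simp: fv_tm_subst_tm)

lemma finite_fv_tm [simp]: "finite (fv_tm t)"
  by (induction t) auto

lemma finite_fv [simp]: "finite (fv \<phi>)"
proof (induction \<phi>)
  case (Forall \<phi>)
  then show ?case using finite_vimageI[of "fv \<phi>" Suc] by (simp add: vimage_def)
next
  case (Exists \<phi>)
  then show ?case using finite_vimageI[of "fv \<phi>" Suc] by (simp add: vimage_def)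
qed auto

lemma subst_up_lift: "subst (up \<sigma>) (lift \<phi>) = lift (subst \<sigma> \<phi>)"
  by (simp add: lift_def subst_subst shift_def)

lemma subst_inst: "subst \<sigma> (inst t \<phi>) = inst (subst_tm \<sigma> t) (subst (up \<sigma>) \<phi>)"
proof -
  have "(\<lambda>n. subst_tm \<sigma> (case_nat t Var n)) =
      (\<lambda>n. subst_tm (case_nat (subst_tm \<sigma> t) Var) (up \<sigma> n))"
    by (auto simp: fun_eq_iff up_def shift_def subst_tm_subst_tm split: nat.split)
  then show ?thesis by (simp add: inst_def subst_subst)
qed

lemma inst_subst_up: "inst t (subst (up \<sigma>) \<phi>) = subst (case_nat t \<sigma>) \<phi>"
proof -
  have "(\<lambda>n. subst_tm (case_nat t Var) (up \<sigma> n)) = case_nat t \<sigma>"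
    by (auto simp: fun_eq_iff up_def shift_def subst_tm_subst_tm split: nat.split)
  then show ?thesis by (simp add: inst_def subst_subst)
qed

lemma inst_simps [simp]:
  "inst t Falsum = Falsum" "inst t (Imp \<phi> \<psi>) = Imp (inst t \<phi>) (inst t \<psi>)"
  by (simp_all add: inst_def)


section \<open>Structural properties of derivations\<close>

lemma weakening: "\<Gamma> \<turnstile> \<phi> \<Longrightarrow> \<Gamma> \<subseteq> \<Delta> \<Longrightarrow> \<Delta> \<turnstile> \<phi>"
proof (induction arbitrary: \<Delta> rule: prv.induct)
  case (Contr \<phi> \<Gamma>)
  then show ?case by (meson insert_mono prv.Contr)
next
  case (ImpI \<phi> \<Gamma> \<psi>)
  then show ?case by (meson insert_mono prv.ImpI)
next
  case (DisjE \<Gamma> \<phi> \<psi> \<chi>)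
  then show ?case by (meson insert_mono prv.DisjE)
next
  case (ForallI \<Gamma> \<phi>)
  then show ?case by (meson image_mono prv.ForallI)
next
  case (ExistsE \<Gamma> \<phi> \<chi>)
  then show ?case by (meson image_mono insert_mono prv.ExistsE)
qed (blast intro: prv.intros)+

lemma prv_insert: "\<Gamma> \<turnstile> \<phi> \<Longrightarrow> insert \<psi> \<Gamma> \<turnstile> \<phi>"
  by (rule weakening) auto

lemma cut: "\<Gamma> \<turnstile> \<phi> \<Longrightarrow> insert \<phi> \<Gamma> \<turnstile> \<psi> \<Longrightarrow> \<Gamma> \<turnstile> \<psi>"
  by (meson ImpE ImpI)

lemma prv_subst: "\<Gamma> \<turnstile> \<phi> \<Longrightarrow> subst \<sigma> ` \<Gamma> \<turnstile> subst \<sigma> \<phi>"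
proof (induction arbitrary: \<sigma> rule: prv.induct)
  case (ForallI \<Gamma> \<phi>)
  have "subst (up \<sigma>) ` lift ` \<Gamma> = lift ` subst \<sigma> ` \<Gamma>" by (simp add: image_image subst_up_lift)
  then show ?case using ForallI.IH[of "up \<sigma>"] by (simp add: prv.ForallI)
next
  case (ExistsE \<Gamma> \<phi> \<chi>)
  have "subst (up \<sigma>) ` lift ` \<Gamma> = lift ` subst \<sigma> ` \<Gamma>" by (simp add: image_image subst_up_lift)
  then show ?case using ExistsE.IH(1)[of \<sigma>] ExistsE.IH(2)[of "up \<sigma>"]
    by (simp add: subst_up_lift) (rule prv.ExistsE)
next
  case (ForallE \<Gamma> \<phi> t)
  then show ?case by (simp add: subst_inst prv.ForallE)
next
  case (ExistsI \<Gamma> t \<phi>)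
  then show ?case by (simp add: subst_inst) (rule prv.ExistsI)
next
  case (EqSubst \<Gamma> s t \<phi>)
  then show ?case by (simp add: subst_inst) (rule prv.EqSubst)
next
  case (Contr \<phi> \<Gamma>)
  then show ?case by (simp add: prv.Contr)
next
  case (ImpI \<phi> \<Gamma> \<psi>)
  then show ?case by (simp add: prv.ImpI)
next
  case (DisjE \<Gamma> \<phi> \<psi> \<chi>)
  show ?case using DisjE.IH(1)[of \<sigma>] DisjE.IH(2)[of \<sigma>] DisjE.IH(3)[of \<sigma>]
    by simp (rule prv.DisjE)
qed (auto intro: prv.intros)

text \<open>Derivations are finite. This serves twice: for the consistency of the union in the
  Henkin construction, and to leave only finitely many instances of the scheme.\<close>

lemma finite_support: "\<Gamma> \<turnstile> \<phi> \<Longrightarrow> \<exists>\<Delta>\<subseteq>\<Gamma>. finite \<Delta> \<and> \<Delta> \<turnstile> \<phi>"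
proof -
  have union: "\<exists>\<Delta>\<subseteq>\<Gamma>. finite \<Delta> \<and> \<Delta> \<turnstile> \<phi> \<and> \<Delta> \<turnstile> \<psi>"
    if "\<exists>\<Delta>\<subseteq>\<Gamma>. finite \<Delta> \<and> \<Delta> \<turnstile> \<phi>" "\<exists>\<Delta>\<subseteq>\<Gamma>. finite \<Delta> \<and> \<Delta> \<turnstile> \<psi>" for \<Gamma> \<phi> \<psi>
    using that by (meson finite_UnI le_sup_iff sup_ge1 sup_ge2 weakening)
  have ins: "\<exists>\<Delta>\<subseteq>\<Gamma>. finite \<Delta> \<and> insert \<chi> \<Delta> \<turnstile> \<psi>"
    if "\<exists>\<Delta>\<subseteq>insert \<chi> \<Gamma>. finite \<Delta> \<and> \<Delta> \<turnstile> \<psi>" for \<Gamma> \<chi> \<psi>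
  proof -
    from that obtain \<Delta> where "\<Delta> \<subseteq> insert \<chi> \<Gamma>" "finite \<Delta>" "\<Delta> \<turnstile> \<psi>" by blast
    then show ?thesis
      by (intro exI[of _ "\<Delta> - {\<chi>}"]) (auto intro: weakening)
  qed
  \<comment> \<open>Under a binder, a finite set of lifted formulas is the lift of a finite
    set.\<close>
  have img: "\<exists>\<Delta>\<subseteq>\<Gamma>. finite \<Delta> \<and> insert \<chi> (lift ` \<Delta>) \<turnstile> \<psi>"
    if "\<exists>\<Delta>\<subseteq>insert \<chi> (lift ` \<Gamma>). finite \<Delta> \<and> \<Delta> \<turnstile> \<psi>" for \<Gamma> \<chi> \<psi>
    using ins[OF that] by (metis finite_subset_image)
  assume "\<Gamma> \<turnstile> \<phi>"
  then show ?thesis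
  proof (induction rule: prv.induct)
    case (Assm \<phi> \<Gamma>)
    then show ?case by (intro exI[of _ "{\<phi>}"]) (auto intro: prv.Assm)
  next
    case (Contr \<phi> \<Gamma>)
    then show ?case using ins prv.Contr by meson
  next
    case (ImpI \<phi> \<Gamma> \<psi>)
    then show ?case using ins prv.ImpI by meson
  next
    case (ImpE \<Gamma> \<phi> \<psi>)
    then show ?case using union prv.ImpE by meson
  next
    case (ConjI \<Gamma> \<phi> \<psi>)
    then show ?case using union prv.ConjI by meson
  next
    case (DisjE \<Gamma> \<phi> \<psi> \<chi>)
    obtain \<Delta>1 where 1: "\<Delta>1 \<subseteq> \<Gamma>" "finite \<Delta>1" "\<Delta>1 \<turnstile> Disj \<phi> \<psi>" using DisjE by blast
    obtain \<Delta>2 where 2: "\<Delta>2 \<subseteq> \<Gamma>" "finite \<Delta>2" "insert \<phi> \<Delta>2 \<turnstile> \<chi>" using ins[OF DisjE.IH(2)] by blast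
    obtain \<Delta>3 where 3: "\<Delta>3 \<subseteq> \<Gamma>" "finite \<Delta>3" "insert \<psi> \<Delta>3 \<turnstile> \<chi>" using ins[OF DisjE.IH(3)] by blast
    let ?\<Delta> = "\<Delta>1 \<union> \<Delta>2 \<union> \<Delta>3"
    have "?\<Delta> \<turnstile> \<chi>"
      by (rule prv.DisjE[of _ \<phi> \<psi>])
        (rule weakening[OF 1(3)] weakening[OF 2(3)] weakening[OF 3(3)]; blast)+
    then show ?case using 1 2 3 by (intro exI[of _ ?\<Delta>]) auto
  next
    case (ForallI \<Gamma> \<phi>)
    then show ?case by (metis finite_subset_image prv.ForallI)
  next
    case (ExistsE \<Gamma> \<phi> \<chi>)
    obtain \<Delta>1 where 1: "\<Delta>1 \<subseteq> \<Gamma>" "finite \<Delta>1" "\<Delta>1 \<turnstile> Exists \<phi>" using ExistsE by blast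
    obtain \<Delta>2 where 2: "\<Delta>2 \<subseteq> \<Gamma>" "finite \<Delta>2" "insert \<phi> (lift ` \<Delta>2) \<turnstile> lift \<chi>"
      using img[OF ExistsE.IH(2)] by blast
    have "\<Delta>1 \<union> \<Delta>2 \<turnstile> \<chi>"
      by (rule prv.ExistsE[of _ \<phi>]) (rule weakening[OF 1(3)] weakening[OF 2(3)]; blast)+
    then show ?case using 1 2 by (intro exI[of _ "\<Delta>1 \<union> \<Delta>2"]) auto
  next
    case (EqSubst \<Gamma> s t \<phi>)
    then show ?case using union prv.EqSubst by meson
  next
    case (EqRefl \<Gamma> t)
    then show ?case using prv.EqRefl by blast
  qed (blast intro: prv.intros)+
qed

text \<open>The free variable \<open>c\<close> acts as a Henkin constant. As it occurs nowhere else,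
  a renaming can move it to index 0 and all others up by one, which produces the context that
  \<open>ExistsE\<close> asks for.\<close>

lemma fresh_witness:
  assumes "insert (inst (Var c) \<theta>) \<Gamma> \<turnstile> Falsum" "\<Gamma> \<turnstile> Exists \<theta>"
    and "\<And>\<phi>. \<phi> \<in> \<Gamma> \<Longrightarrow> c \<notin> fv \<phi>" "c \<notin> fv (Exists \<theta>)"
  shows "\<Gamma> \<turnstile> Falsum"
proof -
  define \<sigma> where "\<sigma> n = (if n = c then Var 0 else Var (Suc n))" for n
  have "subst \<sigma> \<phi> = lift \<phi>" if "\<phi> \<in> \<Gamma>" for \<phi>
    unfolding lift_def using assms(3)[OF that] by (intro subst_fv_cong) (auto simp: \<sigma>_def)
  then have \<Gamma>: "subst \<sigma> ` \<Gamma> = lift ` \<Gamma>" by simp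
  have "subst \<sigma> (inst (Var c) \<theta>) = subst (case_nat (Var 0) \<sigma>) \<theta>"
    by (simp add: subst_inst inst_subst_up) (simp add: \<sigma>_def)
  also have "\<dots> = subst Var \<theta>"
    using assms(4) by (intro subst_fv_cong) (auto simp: \<sigma>_def split: nat.split)
  finally have "insert \<theta> (lift ` \<Gamma>) \<turnstile> Falsum"
    using prv_subst[OF assms(1), of \<sigma>] \<Gamma> by simp
  then show ?thesis using assms(2) ExistsE[of \<Gamma> \<theta> Falsum] by (simp add: lift_def)
qed

lemma not_Forall:
  assumes "\<Gamma> \<turnstile> Neg (Forall \<phi>)" shows "\<Gamma> \<turnstile> Exists (Neg \<phi>)"
proof (rule Contr)
  let ?\<Gamma> = "insert (Neg (Exists (Neg \<phi>))) \<Gamma>"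
  have "lift ` ?\<Gamma> \<turnstile> \<phi>"
  proof (rule Contr)
    let ?\<Delta> = "insert (Neg \<phi>) (lift ` ?\<Gamma>)"
    \<comment> \<open>Lifting the assumption \<open>Neg (Exists (Neg \<phi>))\<close> renames under
      its quantifier; the instance of the renamed body at \<open>Var 0\<close> is again
      \<open>Neg \<phi>\<close>.\<close>
    let ?\<phi> = "subst (up (\<lambda>n. Var (Suc n))) \<phi>"
    have "case_nat (Var 0) (\<lambda>n. Var (Suc n)) = Var" by (auto simp: fun_eq_iff split: nat.split)
    then have "inst (Var 0) (Neg ?\<phi>) = Neg \<phi>" by (simp add: inst_subst_up)
    then have "?\<Delta> \<turnstile> Exists (Neg ?\<phi>)" by (intro ExistsI[of _ "Var 0"] Assm) simp
    moreover have "?\<Delta> \<turnstile> Neg (Exists (Neg ?\<phi>))" by (rule Assm) (simp add: lift_def)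
    ultimately show "?\<Delta> \<turnstile> Falsum" by (rule ImpE[rotated])
  qed
  then have "?\<Gamma> \<turnstile> Forall \<phi>" by (rule ForallI)
  then show "?\<Gamma> \<turnstile> Falsum" using prv_insert[OF assms] by (rule ImpE[rotated])
qed


section \<open>Structures and soundness\<close>

record 'a arith =
  zer :: 'a
  suc :: "'a \<Rightarrow> 'a"
  pls :: "'a \<Rightarrow> 'a \<Rightarrow> 'a"
  tms :: "'a \<Rightarrow> 'a \<Rightarrow> 'a"
  lss :: "'a \<Rightarrow> 'a \<Rightarrow> bool"

primrec teval :: "'a arith \<Rightarrow> (nat \<Rightarrow> 'a) \<Rightarrow> tm \<Rightarrow> 'a" where
  "teval M e (Var n) = e n"
| "teval M e Zero = zer M"
| "teval M e (Sc t) = suc M (teval M e t)"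
| "teval M e (Add s t) = pls M (teval M e s) (teval M e t)"
| "teval M e (Mul s t) = tms M (teval M e s) (teval M e t)"

primrec msat :: "'a arith \<Rightarrow> (nat \<Rightarrow> 'a) \<Rightarrow> fm \<Rightarrow> bool" where
  "msat M e Falsum \<longleftrightarrow> False"
| "msat M e (Equal s t) \<longleftrightarrow> teval M e s = teval M e t"
| "msat M e (Less s t) \<longleftrightarrow> lss M (teval M e s) (teval M e t)"
| "msat M e (Imp \<phi> \<psi>) \<longleftrightarrow> (msat M e \<phi> \<longrightarrow> msat M e \<psi>)"
| "msat M e (Conj \<phi> \<psi>) \<longleftrightarrow> msat M e \<phi> \<and> msat M e \<psi>"
| "msat M e (Disj \<phi> \<psi>) \<longleftrightarrow> msat M e \<phi> \<or> msat M e \<psi>"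
| "msat M e (Forall \<phi>) \<longleftrightarrow> (\<forall>x. msat M (case_nat x e) \<phi>)"
| "msat M e (Exists \<phi>) \<longleftrightarrow> (\<exists>x. msat M (case_nat x e) \<phi>)"

definition standard :: "nat arith" where
  "standard = \<lparr>zer = 0, suc = Suc, pls = (+), tms = (*), lss = (<)\<rparr>"

lemma standard_simps [simp]:
  "zer standard = 0" "suc standard = Suc" "pls standard = (+)" "tms standard = (*)"
  "lss standard = (<)"
  by (simp_all add: standard_def)

lemma teval_standard: "teval standard e t = eval_tm e t"
  by (induction t) auto

lemma msat_standard: "msat standard e \<phi> \<longleftrightarrow> sat e \<phi>"
  by (induction \<phi> arbitrary: e) (auto simp: teval_standard)

lemma teval_subst_tm [simp]: "teval M e (subst_tm \<sigma> t) = teval M (\<lambda>n. teval M e (\<sigma> n)) t"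
  by (induction t) auto

lemma teval_shift [simp]: "teval M e (shift k t) = teval M (\<lambda>n. e (n + k)) t"
  by (simp add: shift_def)

lemma teval_up: "(\<lambda>n. teval M (case_nat x e) (up \<sigma> n)) = case_nat x (\<lambda>n. teval M e (\<sigma> n))"
  by (auto simp: up_def fun_eq_iff split: nat.split)

lemma msat_subst [simp]: "msat M e (subst \<sigma> \<phi>) \<longleftrightarrow> msat M (\<lambda>n. teval M e (\<sigma> n)) \<phi>"
  by (induction \<phi> arbitrary: e \<sigma>) (auto simp: teval_up)

lemma msat_lift [simp]: "msat M (case_nat x e) (lift \<phi>) \<longleftrightarrow> msat M e \<phi>"
  by (simp add: lift_def)

lemma teval_case_nat: "(\<lambda>n. teval M e (case_nat t \<sigma> n)) = case_nat (teval M e t) (\<lambda>n. teval M e (\<sigma> n))"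
  by (auto simp: fun_eq_iff split: nat.split)

lemma msat_inst [simp]: "msat M e (inst t \<phi>) \<longleftrightarrow> msat M (case_nat (teval M e t) e) \<phi>"
  by (simp add: inst_def teval_case_nat)

lemma msat_rename1 [simp]:
  "msat M (case_nat x (case_nat y e)) (rename1 \<phi>) \<longleftrightarrow> msat M (case_nat x e) \<phi>"
  by (simp add: rename1_def teval_case_nat)

lemma msat_Exists1: "msat M e (Exists1 \<phi>) \<longleftrightarrow> (\<exists>!y. msat M (case_nat y e) \<phi>)"
  by (auto simp: Exists1_def)

theorem model_soundness: "\<Gamma> \<turnstile> \<phi> \<Longrightarrow> \<forall>\<psi>\<in>\<Gamma>. msat M e \<psi> \<Longrightarrow> msat M e \<phi>"
proof (induction arbitrary: e rule: prv.induct)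
  case (ExistsE \<Gamma> \<phi> \<chi>)
  then obtain x where x: "msat M (case_nat x e) \<phi>" by fastforce
  then have "\<forall>\<psi>\<in>insert \<phi> (lift ` \<Gamma>). msat M (case_nat x e) \<psi>" using ExistsE.prems by simp
  then have "msat M (case_nat x e) (lift \<chi>)" using ExistsE.IH(2) by blast
  then show ?case by simp
next
  case (DisjE \<Gamma> \<phi> \<psi> \<chi>)
  then have "msat M e \<phi> \<or> msat M e \<psi>" by simp
  with DisjE show ?case by auto
qed (auto; fail)+


section \<open>Completeness\<close>

instance tm :: countable by countable_datatype
instance fm :: countable by countable_datatype

definition consistent :: "fm set \<Rightarrow> bool" where
  "consistent \<Gamma> \<longleftrightarrow> \<not> \<Gamma> \<turnstile> Falsum"

lemma consistent_mono: "consistent \<Delta> \<Longrightarrow> \<Gamma> \<subseteq> \<Delta> \<Longrightarrow> consistent \<Gamma>"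
  unfolding consistent_def using weakening by blast

text \<open>Free variables play the role of the Henkin constants.\<close>

definition fresh_var :: "fm set \<Rightarrow> nat" where
  "fresh_var \<Gamma> = (SOME c. c \<notin> (\<Union>\<phi>\<in>\<Gamma>. fv \<phi>))"

definition henkin_step :: "fm \<Rightarrow> fm set \<Rightarrow> fm set" where
  "henkin_step \<psi> \<Gamma> = (if consistent (insert \<psi> \<Gamma>)
    then insert \<psi> \<Gamma> \<union> {inst (Var (fresh_var (insert \<psi> \<Gamma>))) \<theta> | \<theta>. \<psi> = Exists \<theta>}
    else \<Gamma>)"

text \<open>Finiteness of the set of occurring variables is carried along because it guarantees a
  fresh variable for the next witness.\<close>

lemma henkin_step:
  assumes "consistent \<Gamma>" "finite (\<Union>\<phi>\<in>\<Gamma>. fv \<phi>)"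
  shows "consistent (henkin_step \<psi> \<Gamma>)" "finite (\<Union>\<phi>\<in>henkin_step \<psi> \<Gamma>. fv \<phi>)"
proof -
  let ?\<Delta> = "insert \<psi> \<Gamma>"
  have \<Delta>: "finite (\<Union>\<phi>\<in>?\<Delta>. fv \<phi>)" using assms(2) by simp
  then have fresh: "fresh_var ?\<Delta> \<notin> (\<Union>\<phi>\<in>?\<Delta>. fv \<phi>)"
    unfolding fresh_var_def by (rule someI_ex[OF ex_new_if_finite[OF infinite_UNIV_nat]])
  show "consistent (henkin_step \<psi> \<Gamma>)"
  proof (cases "consistent ?\<Delta> \<and> (\<exists>\<theta>. \<psi> = Exists \<theta>)")
    case True
    then obtain \<theta> where \<theta>: "\<psi> = Exists \<theta>" by blast
    have "\<not> insert (inst (Var (fresh_var ?\<Delta>)) \<theta>) ?\<Delta> \<turnstile> Falsum"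
    proof
      assume "insert (inst (Var (fresh_var ?\<Delta>)) \<theta>) ?\<Delta> \<turnstile> Falsum"
      moreover have "?\<Delta> \<turnstile> Exists \<theta>" by (rule Assm) (simp add: \<theta>)
      ultimately have "?\<Delta> \<turnstile> Falsum"
        by (rule fresh_witness) (use fresh \<theta> in auto)
      then show False using True by (simp add: consistent_def)
    qed
    moreover have "henkin_step \<psi> \<Gamma> = insert (inst (Var (fresh_var ?\<Delta>)) \<theta>) ?\<Delta>"
      using True by (auto simp: henkin_step_def \<theta>)
    ultimately show ?thesis by (simp add: consistent_def)
  next
    case False
    then have "henkin_step \<psi> \<Gamma> = ?\<Delta> \<and> consistent ?\<Delta> \<or> henkin_step \<psi> \<Gamma> = \<Gamma>"
      by (auto simp: henkin_step_def)
    then show ?thesis using assms(1) by auto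
  qed
  have "finite {inst (Var (fresh_var ?\<Delta>)) \<theta> | \<theta>. \<psi> = Exists \<theta>}"
    by (cases \<psi>) auto
  then show "finite (\<Union>\<phi>\<in>henkin_step \<psi> \<Gamma>. fv \<phi>)"
    using \<Delta> assms(2) by (simp add: henkin_step_def)
qed

locale henkin =
  fixes H :: "fm set"
  assumes cons: "consistent H"
    and maximal: "consistent (insert \<psi> H) \<Longrightarrow> \<psi> \<in> H"
    and witness: "Exists \<theta> \<in> H \<Longrightarrow> \<exists>t. inst t \<theta> \<in> H"

text \<open>All formulas are run through in a countable enumeration. A formula consistent with the
  union was consistent at its own stage, hence was added there together with a witness.\<close>

lemma henkin_extension:
  assumes "consistent \<Gamma>" "finite (\<Union>\<phi>\<in>\<Gamma>. fv \<phi>)"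
  obtains H where "henkin H" "\<Gamma> \<subseteq> H"
proof -
  define F where "F = rec_nat \<Gamma> (\<lambda>n. henkin_step (from_nat n))"
  have F0: "F 0 = \<Gamma>" and F_Suc: "F (Suc n) = henkin_step (from_nat n) (F n)" for n
    by (simp_all add: F_def)
  have F: "consistent (F n) \<and> finite (\<Union>\<phi>\<in>F n. fv \<phi>)" for n
    by (induction n) (use assms henkin_step in \<open>simp_all add: F0 F_Suc\<close>)
  have "F n \<subseteq> F (Suc n)" for n by (auto simp: F_Suc henkin_step_def)
  then have mono: "F m \<subseteq> F n" if "m \<le> n" for m n using that by (rule lift_Suc_mono_le)
  define H where "H = (\<Union>n. F n)"
  have sub: "F n \<subseteq> H" for n by (auto simp: H_def)
  have fin: "\<exists>n. \<Delta> \<subseteq> F n" if "finite \<Delta>" "\<Delta> \<subseteq> H" for \<Delta>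
    using that
  proof (induction \<Delta>)
    case (insert x \<Delta>)
    then obtain m n where "\<Delta> \<subseteq> F m" "x \<in> F n" by (auto simp: H_def)
    then have "insert x \<Delta> \<subseteq> F (max m n)" using mono[of m "max m n"] mono[of n "max m n"] by auto
    then show ?case by blast
  qed simp
  have cons: "consistent H"
    unfolding consistent_def
  proof
    assume "H \<turnstile> Falsum"
    then obtain \<Delta> where "\<Delta> \<subseteq> H" "finite \<Delta>" "\<Delta> \<turnstile> Falsum" using finite_support by blast
    moreover then obtain n where "\<Delta> \<subseteq> F n" using fin by blast
    ultimately have "F n \<turnstile> Falsum" using weakening by blast
    then show False using F by (simp add: consistent_def)
  qed
  have added: "\<psi> \<in> H \<and> (\<forall>\<theta>. \<psi> = Exists \<theta> \<longrightarrow> (\<exists>t. inst t \<theta> \<in> H))"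
    if "consistent (insert \<psi> H)" for \<psi>
  proof -
    define n where "n = to_nat \<psi>"
    have "consistent (insert \<psi> (F n))" by (rule consistent_mono[OF that]) (use sub in auto)
    then have "F (Suc n) = insert \<psi> (F n) \<union>
        {inst (Var (fresh_var (insert \<psi> (F n)))) \<theta> | \<theta>. \<psi> = Exists \<theta>}"
      by (simp add: F_Suc henkin_step_def n_def)
    then have "insert \<psi> (F n) \<union>
        {inst (Var (fresh_var (insert \<psi> (F n)))) \<theta> | \<theta>. \<psi> = Exists \<theta>} \<subseteq> H"
      using sub[of "Suc n"] by simp
    then show ?thesis by auto
  qed
  have "henkin H"
  proof
    fix \<theta> assume "Exists \<theta> \<in> H"
    then have "consistent (insert (Exists \<theta>) H)" using cons by (simp add: insert_absorb)
    then show "\<exists>t. inst t \<theta> \<in> H" using added by blast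
  qed (use cons added in auto)
  then show thesis using that sub[of 0] F0 by simp
qed

context henkin
begin

section \<open>Membership in a Henkin set behaves like truth\<close>

lemma closed: "H \<turnstile> \<psi> \<Longrightarrow> \<psi> \<in> H"
  using cons cut[of H \<psi> Falsum] maximal[of \<psi>] by (auto simp: consistent_def)

lemma member: "\<psi> \<in> H \<Longrightarrow> H \<turnstile> \<psi>"
  by (rule Assm)

lemma Falsum_iff: "Falsum \<notin> H"
  using cons member by (auto simp: consistent_def)

lemma Imp_iff: "Imp \<phi> \<psi> \<in> H \<longleftrightarrow> (\<phi> \<in> H \<longrightarrow> \<psi> \<in> H)"
proof
  assume "Imp \<phi> \<psi> \<in> H"
  then show "\<phi> \<in> H \<longrightarrow> \<psi> \<in> H" using ImpE closed member by blast
next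
  assume *: "\<phi> \<in> H \<longrightarrow> \<psi> \<in> H"
  show "Imp \<phi> \<psi> \<in> H"
  proof (cases "\<phi> \<in> H")
    case True
    then have "H \<turnstile> \<psi>" using * member by blast
    then show ?thesis using closed[OF ImpI[OF prv_insert]] by simp
  next
    case False
    then have "insert \<phi> H \<turnstile> Falsum" using maximal by (auto simp: consistent_def)
    then have "insert (Neg \<psi>) (insert \<phi> H) \<turnstile> Falsum" by (rule prv_insert)
    then show ?thesis using closed[OF ImpI[OF Contr]] by simp
  qed
qed

lemma Conj_iff: "Conj \<phi> \<psi> \<in> H \<longleftrightarrow> \<phi> \<in> H \<and> \<psi> \<in> H"
  using ConjI ConjE1 ConjE2 closed member by blast

lemma Disj_iff: "Disj \<phi> \<psi> \<in> H \<longleftrightarrow> \<phi> \<in> H \<or> \<psi> \<in> H"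
proof
  assume *: "Disj \<phi> \<psi> \<in> H"
  show "\<phi> \<in> H \<or> \<psi> \<in> H"
  proof (rule ccontr)
    assume "\<not> (\<phi> \<in> H \<or> \<psi> \<in> H)"
    then have "insert \<phi> H \<turnstile> Falsum" "insert \<psi> H \<turnstile> Falsum"
      using maximal by (auto simp: consistent_def)
    then have "H \<turnstile> Falsum" using DisjE member * by blast
    then show False using cons by (simp add: consistent_def)
  qed
next
  show "Disj \<phi> \<psi> \<in> H" if "\<phi> \<in> H \<or> \<psi> \<in> H"
    using that DisjI1 DisjI2 closed member by blast
qed

lemma Exists_iff: "Exists \<theta> \<in> H \<longleftrightarrow> (\<exists>t. inst t \<theta> \<in> H)"
  using ExistsI closed member witness by blast

lemma Forall_iff: "Forall \<theta> \<in> H \<longleftrightarrow> (\<forall>t. inst t \<theta> \<in> H)"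
proof
  show "Forall \<theta> \<in> H \<Longrightarrow> \<forall>t. inst t \<theta> \<in> H" using ForallE closed member by blast
  assume *: "\<forall>t. inst t \<theta> \<in> H"
  show "Forall \<theta> \<in> H"
  proof (rule ccontr)
    assume "Forall \<theta> \<notin> H"
    then have "Neg (Forall \<theta>) \<in> H" by (simp add: Imp_iff)
    then have "Exists (Neg \<theta>) \<in> H" using not_Forall closed member by blast
    then obtain t where "inst t (Neg \<theta>) \<in> H" using Exists_iff by blast
    then show False using * by (simp add: Imp_iff Falsum_iff)
  qed
qed

section \<open>Equality as a congruence\<close>

lemma Leibniz: "Equal s t \<in> H \<Longrightarrow> inst s \<phi> \<in> H \<Longrightarrow> inst t \<phi> \<in> H"
  using EqSubst closed member by blast

lemma inst_tm_shift [simp]: "subst_tm (case_nat t Var) (shift (Suc 0) s) = s"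
  by (simp add: shift_def subst_tm_subst_tm)

lemma eq_refl: "Equal t t \<in> H"
  by (intro closed EqRefl)

text \<open>Index 0 of \<open>u\<close> marks the place of replacement. The left side of the
  reflexivity instance is shifted so that replacing \<open>s\<close> leaves it alone.\<close>

lemma eq_cong:
  assumes "Equal s t \<in> H"
  shows "Equal (subst_tm (case_nat s Var) u) (subst_tm (case_nat t Var) u) \<in> H"
proof -
  have "inst t (Equal (shift 1 (subst_tm (case_nat s Var) u)) u) \<in> H"
    by (rule Leibniz[OF assms]) (simp add: inst_def eq_refl)
  then show ?thesis by (simp add: inst_def)
qed

lemma eq_sym: assumes "Equal s t \<in> H" shows "Equal t s \<in> H"
proof -
  have "inst t (Equal (Var 0) (shift 1 s)) \<in> H"
    by (rule Leibniz[OF assms]) (simp add: inst_def eq_refl)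
  then show ?thesis by (simp add: inst_def)
qed

lemma eq_trans: assumes "Equal s t \<in> H" "Equal t u \<in> H" shows "Equal s u \<in> H"
proof -
  have "inst u (Equal (shift 1 s) (Var 0)) \<in> H"
    by (rule Leibniz[OF assms(2)]) (use assms in \<open>simp add: inst_def\<close>)
  then show ?thesis by (simp add: inst_def)
qed

lemma eq_Sc: "Equal s t \<in> H \<Longrightarrow> Equal (Sc s) (Sc t) \<in> H"
  using eq_cong[of s t "Sc (Var 0)"] by simp

lemma eq_Add: "Equal s t \<in> H \<Longrightarrow> Equal u v \<in> H \<Longrightarrow> Equal (Add s u) (Add t v) \<in> H"
  using eq_cong[of s t "Add (Var 0) (shift 1 u)"] eq_cong[of u v "Add (shift 1 t) (Var 0)"]
  by (auto intro: eq_trans)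

lemma eq_Mul: "Equal s t \<in> H \<Longrightarrow> Equal u v \<in> H \<Longrightarrow> Equal (Mul s u) (Mul t v) \<in> H"
  using eq_cong[of s t "Mul (Var 0) (shift 1 u)"] eq_cong[of u v "Mul (shift 1 t) (Var 0)"]
  by (auto intro: eq_trans)

lemma eq_Less:
  assumes "Equal s t \<in> H" "Equal u v \<in> H" "Less s u \<in> H" shows "Less t v \<in> H"
proof -
  have "inst t (Less (Var 0) (shift 1 u)) \<in> H"
    by (rule Leibniz[OF assms(1)]) (use assms in \<open>simp add: inst_def\<close>)
  then have "inst v (Less (shift 1 t) (Var 0)) \<in> H"
    by (intro Leibniz[OF assms(2)]) (simp add: inst_def)
  then show ?thesis by (simp add: inst_def)
qed

text \<open>The basic axioms make the set of classes of terms infinite, so that its elements can be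
  represented by all natural numbers and no separate domain of a structure is needed.\<close>

lemma classes:
  assumes "basic_axioms \<subseteq> H"
  obtains h :: "tm \<Rightarrow> nat" where "surj h" "\<And>s t. h s = h t \<longleftrightarrow> Equal s t \<in> H"
proof -
  define R where "R = {(s, t). Equal s t \<in> H}"
  have R: "equiv UNIV R"
    by (rule equivI) (auto simp: R_def refl_on_def sym_def trans_def eq_refl
        intro: eq_sym eq_trans)
  \<comment> \<open>By the successor axioms the numerals are pairwise unequal modulo
    \<open>H\<close>, which makes the quotient infinite.\<close>
  define num where "num n = (Sc ^^ n) Zero" for n
  have "Forall (Neg (Equal (Sc (Var 0)) Zero)) \<in> H"
    using assms by (auto simp: basic_axioms_def)
  then have "inst t (Neg (Equal (Sc (Var 0)) Zero)) \<in> H" for t using Forall_iff by blast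
  then have zero: "Equal (Sc t) Zero \<notin> H" for t
    by (simp add: inst_def Imp_iff Falsum_iff)
  let ?inj = "Imp (Equal (Sc (Var 1)) (Sc (Var 0))) (Equal (Var 1) (Var 0))"
  have "Forall (Forall ?inj) \<in> H"
    using assms by (auto simp: basic_axioms_def)
  then have "inst s (Forall ?inj) \<in> H" for s using Forall_iff by blast
  moreover have "inst s (Forall ?inj) = Forall (subst (up (case_nat s Var)) ?inj)" for s
    unfolding inst_def by (rule subst.simps)
  ultimately have "inst t (subst (up (case_nat s Var)) ?inj) \<in> H" for s t
    using Forall_iff by simp
  then have inj: "Equal (Sc s) (Sc t) \<in> H \<Longrightarrow> Equal s t \<in> H" for s t
    by (simp only: inst_subst_up) (simp add: Imp_iff)
  have num: "m = n" if "Equal (num m) (num n) \<in> H" for m n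
    using that
  proof (induction m arbitrary: n)
    case 0
    then show ?case using zero eq_sym by (cases n) (auto simp: num_def)
  next
    case (Suc m)
    then obtain n' where n': "n = Suc n'" using zero by (cases n) (auto simp: num_def)
    have "Equal (num m) (num n') \<in> H" by (rule inj) (use Suc.prems in \<open>simp add: num_def n'\<close>)
    then show ?case using Suc.IH n' by simp
  qed
  have "inj (\<lambda>n. R `` {num n})"
  proof (rule injI)
    fix m n assume "R `` {num m} = R `` {num n}"
    then have "(num m, num n) \<in> R" using R by (simp add: eq_equiv_class)
    then show "m = n" using num by (simp add: R_def)
  qed
  then have "infinite (range (\<lambda>n. R `` {num n}))" by (rule range_inj_infinite)
  moreover have "range (\<lambda>n. R `` {num n}) \<subseteq> UNIV // R" by (auto intro: quotientI)
  ultimately have "infinite (UNIV // R)" using finite_subset by blast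
  moreover have ctb: "countable (UNIV // R)" by (simp add: quotient_def)
  ultimately have bij: "bij_betw (to_nat_on (UNIV // R)) (UNIV // R) UNIV"
    by (rule to_nat_on_infinite[rotated])
  define h where "h t = to_nat_on (UNIV // R) (R `` {t})" for t
  have "h s = h t \<longleftrightarrow> Equal s t \<in> H" for s t
  proof -
    have "h s = h t \<longleftrightarrow> R `` {s} = R `` {t}"
      unfolding h_def by (rule inj_on_eq_iff[OF bij_betw_imp_inj_on[OF bij]]) (auto intro: quotientI)
    also have "\<dots> \<longleftrightarrow> (s, t) \<in> R" by (rule eq_equiv_class_iff[OF R]) auto
    finally show ?thesis by (simp add: R_def)
  qed
  moreover have "surj h"
  proof -
    have "range h = to_nat_on (UNIV // R) ` (UNIV // R)" by (auto simp: h_def quotient_def)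
    then show ?thesis using bij by (simp add: bij_betw_def)
  qed
  ultimately show thesis using that by blast
qed

text \<open>The truth lemma. A number stands for a class of terms and \<open>g\<close> selects a
  representative; since every term equals a representative modulo \<open>H\<close>, quantifiers over
  numbers match quantifiers over all terms.\<close>

lemma term_model:
  assumes "basic_axioms \<subseteq> H"
  obtains M :: "nat arith" and g :: "nat \<Rightarrow> tm"
  where "\<And>e \<phi>. msat M e \<phi> \<longleftrightarrow> subst (\<lambda>n. g (e n)) \<phi> \<in> H"
proof -
  obtain h :: "tm \<Rightarrow> nat" where h: "surj h" and eq: "\<And>s t. h s = h t \<longleftrightarrow> Equal s t \<in> H"
    by (rule classes[OF assms]) blast
  define g where "g = inv h"
  have hg [simp]: "h (g n) = n" for n by (simp add: g_def h surj_f_inv_f)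
  then have g: "Equal (g (h t)) t \<in> H" for t by (simp add: eq[symmetric])
  define M where "M = \<lparr>zer = h Zero, suc = \<lambda>n. h (Sc (g n)), pls = \<lambda>m n. h (Add (g m) (g n)),
    tms = \<lambda>m n. h (Mul (g m) (g n)), lss = \<lambda>m n. Less (g m) (g n) \<in> H\<rparr>"
  have M: "zer M = h Zero" "suc M (h s) = h (Sc s)" "pls M (h s) (h t) = h (Add s t)"
    "tms M (h s) (h t) = h (Mul s t)" "lss M (h s) (h t) \<longleftrightarrow> Less s t \<in> H" for s t
    using g[of s] g[of t] eq_Less[OF g[of s] g[of t]]
      eq_Less[OF eq_sym[OF g[of s]] eq_sym[OF g[of t]]]
    by (auto simp: M_def eq eq_Sc eq_Add eq_Mul)
  have ev: "teval M e t = h (subst_tm (\<lambda>n. g (e n)) t)" for e t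
    by (induction t) (simp_all add: M)
  have env: "inst (g x) (subst (up (\<lambda>n. g (e n))) \<phi>) = subst (\<lambda>n. g (case_nat x e n)) \<phi>" for x e \<phi>
    unfolding inst_subst_up by (rule arg_cong[of _ _ "\<lambda>\<sigma>. subst \<sigma> \<phi>"]) (auto split: nat.split)
  have "msat M e \<phi> \<longleftrightarrow> subst (\<lambda>n. g (e n)) \<phi> \<in> H" for e \<phi>
  proof (induction \<phi> arbitrary: e)
    case (Forall \<phi>)
    then have "msat M (case_nat x e) \<phi> \<longleftrightarrow> inst (g x) (subst (up (\<lambda>n. g (e n))) \<phi>) \<in> H" for x
      by (simp add: env)
    then show ?case using Leibniz[OF g] by (auto simp: Forall_iff)
  next
    case (Exists \<phi>)
    then have "msat M (case_nat x e) \<phi> \<longleftrightarrow> inst (g x) (subst (up (\<lambda>n. g (e n))) \<phi>) \<in> H" for x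
      by (simp add: env)
    then show ?case using Leibniz[OF eq_sym[OF g]] by (auto simp: Exists_iff)
  qed (auto simp: ev M eq Falsum_iff Imp_iff Conj_iff Disj_iff)
  then show thesis by (rule that)
qed

end

text \<open>An unprovable sentence has a countermodel on the natural numbers: the term model of a
  Henkin set containing its negation. Sentences leave all variables available as witnesses and make
  the choice of environment immaterial.\<close>

theorem completeness:
  assumes sentences: "\<And>\<phi>. \<phi> \<in> insert \<chi> \<Gamma> \<Longrightarrow> fv \<phi> = {}" and "basic_axioms \<subseteq> \<Gamma>"
    and valid: "\<And>M :: nat arith. (\<And>\<phi> e. \<phi> \<in> \<Gamma> \<Longrightarrow> msat M e \<phi>) \<Longrightarrow> \<exists>e. msat M e \<chi>"
  shows "\<Gamma> \<turnstile> \<chi>"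
proof (rule Contr, rule ccontr)
  let ?\<Gamma> = "insert (Neg \<chi>) \<Gamma>"
  assume "\<not> ?\<Gamma> \<turnstile> Falsum"
  moreover have "(\<Union>\<phi>\<in>?\<Gamma>. fv \<phi>) = {}" using sentences by auto
  ultimately obtain H where "henkin H" and sub: "?\<Gamma> \<subseteq> H"
    using henkin_extension[of ?\<Gamma>] by (auto simp: consistent_def)
  interpret henkin H by fact
  obtain M :: "nat arith" and g where M: "\<And>e \<phi>. msat M e \<phi> \<longleftrightarrow> subst (\<lambda>n. g (e n)) \<phi> \<in> H"
    using term_model assms(2) sub by (metis insert_subset subset_trans)
  have "msat M e \<phi>" if "\<phi> \<in> \<Gamma>" for \<phi> e
    using that M sub subst_closed[OF sentences] by auto
  then obtain e where "msat M e \<chi>" using valid by blast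
  then have "\<chi> \<in> H" using M subst_closed[OF sentences] by simp
  moreover have "Neg \<chi> \<in> H" using sub by simp
  ultimately show False by (simp add: Imp_iff Falsum_iff)
qed


section \<open>Models of Peano arithmetic\<close>

lemma fv_Forall_funpow: "fv ((Forall ^^ k) \<phi>) = {n. n + k \<in> fv \<phi>}"
  by (induction k) auto

lemma msat_Forall_funpow:
  assumes "\<And>e. msat M e ((Forall ^^ k) \<phi>)" shows "msat M e \<phi>"
  using assms
proof (induction k arbitrary: e)
  case (Suc k)
  have "msat M e ((Forall ^^ k) \<phi>)" for e
  proof -
    have "case_nat (e 0) (\<lambda>n. e (Suc n)) = e" by (auto simp: fun_eq_iff split: nat.split)
    moreover have "msat M (case_nat (e 0) (\<lambda>n. e (Suc n))) ((Forall ^^ k) \<phi>)"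
      using Suc.prems[of "\<lambda>n. e (Suc n)"] by simp
    ultimately show ?thesis by simp
  qed
  then show ?case by (rule Suc.IH)
qed simp

locale PA_model =
  fixes M :: "'a arith"
  assumes PA: "\<phi> \<in> PA \<Longrightarrow> msat M e \<phi>"
begin

abbreviation "zr \<equiv> zer M"
abbreviation "sc \<equiv> suc M"
abbreviation "ad \<equiv> pls M"
abbreviation "lt \<equiv> lss M"

text \<open>The induction instances in \<open>PA\<close> are closed: prefix more quantifiers than
  there are free indices, then strip them again.\<close>

lemma msat_induction_fm: "msat M e (induction_fm \<phi>)"
proof -
  obtain k where k: "\<forall>n\<in>fv (induction_fm \<phi>). n < k"
    using finite_nat_set_iff_bounded finite_fv by metis
  then have "fv ((Forall ^^ k) (induction_fm \<phi>)) = {}" by (auto simp: fv_Forall_funpow)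
  then have "(Forall ^^ k) (induction_fm \<phi>) \<in> PA" by (auto simp: PA_def)
  then show ?thesis using PA msat_Forall_funpow by blast
qed

text \<open>A possibly nonstandard model has induction for definable predicates only, so each
  application names a formula defining \<open>P\<close>, with its parameters in
  \<open>e\<close>.\<close>

lemma induct_fm:
  assumes P: "\<And>x. msat M (case_nat x e) \<phi> \<longleftrightarrow> P x"
    and "P zr" "\<And>x. P x \<Longrightarrow> P (sc x)"
  shows "P x"
  using msat_induction_fm[of e \<phi>] assms by (simp add: induction_fm_def teval_case_nat P)

section \<open>Addition and order in a model of PA\<close>

lemma axioms:
  "sc x \<noteq> zr" "sc x = sc y \<longleftrightarrow> x = y" "ad x zr = x" "ad x (sc y) = sc (ad x y)"
  "lt x y \<longleftrightarrow> (\<exists>z. ad x (sc z) = y)"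
proof -
  have basic: "msat M (\<lambda>_. zr) \<phi>" if "\<phi> \<in> basic_axioms" for \<phi>
    using that by (simp add: PA PA_def)
  note basic = basic[unfolded basic_axioms_def]
  show "sc x \<noteq> zr"
    using basic[of "Forall (Neg (Equal (Sc (Var 0)) Zero))"] by simp
  show "sc x = sc y \<longleftrightarrow> x = y"
    using basic[of "Forall (Forall (Imp (Equal (Sc (Var 1)) (Sc (Var 0))) (Equal (Var 1) (Var 0))))"]
    by auto
  show "ad x zr = x"
    using basic[of "Forall (Equal (Add (Var 0) Zero) (Var 0))"] by simp
  show "ad x (sc y) = sc (ad x y)"
    using basic[of "Forall (Forall (Equal (Add (Var 1) (Sc (Var 0))) (Sc (Add (Var 1) (Var 0)))))"]
    by simp
  show "lt x y \<longleftrightarrow> (\<exists>z. ad x (sc z) = y)"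
    using basic[of "Forall (Forall (Iff (Less (Var 1) (Var 0))
       (Exists (Equal (Add (Var 2) (Sc (Var 0))) (Var 1)))))"]
    by (auto simp: eval_nat_numeral)
qed

lemma zero_or_suc: "x = zr \<or> (\<exists>y. x = sc y)"
  by (rule induct_fm[of undefined "Disj (Equal (Var 0) Zero) (Exists (Equal (Var 1) (Sc (Var 0))))"])
    auto

lemma zero_add: "ad zr x = x"
  by (rule induct_fm[of undefined "Equal (Add Zero (Var 0)) (Var 0)"]) (auto simp: axioms)

lemma suc_add: "ad (sc x) y = sc (ad x y)"
  by (rule induct_fm[of "\<lambda>_. x" "Equal (Add (Sc (Var 1)) (Var 0)) (Sc (Add (Var 1) (Var 0)))"])
    (auto simp: axioms)

lemma not_lt_zero: "\<not> lt x zr"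
  by (simp add: axioms(1,4,5))

lemma lt_suc: "lt x (sc y) \<longleftrightarrow> lt x y \<or> x = y"
proof
  assume "lt x (sc y)"
  then obtain z where "ad x z = y" by (auto simp: axioms(2,4,5))
  then show "lt x y \<or> x = y" using zero_or_suc[of z] by (auto simp: axioms(3) axioms(5))
next
  assume "lt x y \<or> x = y"
  then obtain z where "ad x z = y" using axioms(3)[of x] axioms(5)[of x y] by metis
  then show "lt x (sc y)" by (auto simp: axioms(2,4,5))
qed

lemma lt_trans: assumes "lt x y" "lt y z" shows "lt x z"
proof -
  let ?\<phi> = "Imp (Less (Var 2) (Var 0)) (Less (Var 1) (Var 0))"
  have "lt y z \<longrightarrow> lt x z"
    by (rule induct_fm[of "case_nat x (\<lambda>_. y)" ?\<phi>])
      (use assms(1) in \<open>auto simp: eval_nat_numeral not_lt_zero lt_suc\<close>)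
  then show ?thesis using assms(2) by blast
qed

lemma zero_le: "x = zr \<or> lt zr x"
  using zero_or_suc[of x] zero_add axioms(5) by metis

lemma lt_linear: "lt x y \<or> x = y \<or> lt y x"
proof -
  let ?\<phi> = "Disj (Less (Var 1) (Var 0)) (Disj (Equal (Var 1) (Var 0)) (Less (Var 0) (Var 1)))"
  have suc_le: "sc z = x \<or> lt (sc z) x" if "lt z x" for z
  proof -
    obtain w where "ad z (sc w) = x" using \<open>lt z x\<close> by (auto simp: axioms(5))
    then have w: "ad (sc z) w = x" by (simp add: suc_add axioms(4))
    then show ?thesis using zero_or_suc[of w] axioms(3) by (auto simp: axioms(5))
  qed
  show ?thesis
    by (rule induct_fm[of "\<lambda>_. x" ?\<phi>]) (use zero_le suc_le in \<open>auto simp: lt_suc\<close>)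
qed

text \<open>The least number principle, by induction on \<open>y\<close> for the statement that no
  element below \<open>y\<close> is a solution.\<close>

lemma least_element:
  assumes "msat M (case_nat x e) \<phi>"
  shows "\<exists>y. msat M (case_nat y e) \<phi> \<and> (\<forall>z. lt z y \<longrightarrow> \<not> msat M (case_nat z e) \<phi>)"
proof (rule ccontr)
  assume no: "\<not> ?thesis"
  have "\<forall>z. lt z y \<longrightarrow> \<not> msat M (case_nat z e) \<phi>" for y
    by (rule induct_fm[of e "Forall (Imp (Less (Var 0) (Var 1)) (Neg (rename1 \<phi>)))"])
      (use no in \<open>auto simp: not_lt_zero lt_suc\<close>)
  then show False using no assms by blast
qed

text \<open>Bounds for two conjuncts have to be merged into one. Asking that all large
  \<open>b\<close> work, rather than some \<open>b\<close>, allows this without monotonicity in the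
  bound.\<close>

definition eventually_large :: "('a \<Rightarrow> bool) \<Rightarrow> bool" where
  "eventually_large P \<longleftrightarrow> (\<exists>b. \<forall>b'. lt b b' \<longrightarrow> P b')"

lemma eventually_large_all: "(\<And>b. P b) \<Longrightarrow> eventually_large P"
  by (simp add: eventually_large_def)

lemma eventually_large_lt: "eventually_large (lt x)"
  by (auto simp: eventually_large_def)

lemma eventually_large_conj:
  assumes "eventually_large P" "eventually_large Q"
  shows "eventually_large (\<lambda>b. P b \<and> Q b)"
  using assms lt_linear lt_trans unfolding eventually_large_def by metis

lemma eventually_large_disj:
  "eventually_large P \<or> eventually_large Q \<Longrightarrow> eventually_large (\<lambda>b. P b \<or> Q b)"
  by (auto simp: eventually_large_def)

lemma eventually_large_mono:
  "eventually_large P \<Longrightarrow> (\<And>b. P b \<Longrightarrow> Q b) \<Longrightarrow> eventually_large Q"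
  by (auto simp: eventually_large_def)

lemma eventually_large_ex: "eventually_large P \<Longrightarrow> \<exists>b. P b"
  using lt_suc by (auto simp: eventually_large_def)

end

lemma PA_model_standard: "PA_model standard"
  by unfold_locales (simp add: msat_standard sat_PA)


section \<open>Bounding the existential quantifiers of a formula\<close>

lemma Delta0_subst: "is_Delta0 \<phi> \<Longrightarrow> is_Delta0 (subst \<sigma> \<phi>)"
proof (induction arbitrary: \<sigma> rule: is_Delta0.induct)
  case (7 \<phi> t)
  have "subst_tm (up \<sigma>) (shift 1 t) = shift 1 (subst_tm \<sigma> t)"
    by (simp add: shift_def subst_tm_subst_tm up_def)
  then show ?case using is_Delta0.intros(7)[OF 7(2)] by simp
next
  case (8 \<phi> t)
  have "subst_tm (up \<sigma>) (shift 1 t) = shift 1 (subst_tm \<sigma> t)"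
    by (simp add: shift_def subst_tm_subst_tm up_def)
  then show ?case using is_Delta0.intros(8)[OF 8(2)] by simp
qed (auto intro: is_Delta0.intros)

text \<open>Existential formulas without conversion to prenex form. There is no clause for bounded
  universal quantifiers in front of existential ones, so bounding the witnesses involves no
  collection principle.\<close>

inductive Sigma_class :: "fm \<Rightarrow> bool" where
  Delta0: "is_Delta0 \<phi> \<Longrightarrow> Sigma_class \<phi>"
| Conj: "Sigma_class \<phi> \<Longrightarrow> Sigma_class \<psi> \<Longrightarrow> Sigma_class (Conj \<phi> \<psi>)"
| Disj: "Sigma_class \<phi> \<Longrightarrow> Sigma_class \<psi> \<Longrightarrow> Sigma_class (Disj \<phi> \<psi>)"
| Exists: "Sigma_class \<phi> \<Longrightarrow> Sigma_class (Exists \<phi>)"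

lemma Sigma_class_subst: "Sigma_class \<phi> \<Longrightarrow> Sigma_class (subst \<sigma> \<phi>)"
  by (induction arbitrary: \<sigma> rule: Sigma_class.induct) (auto intro: Sigma_class.intros Delta0_subst)

text \<open>Index 0 of \<open>\<beta>\<close> is a bound for the witnesses of \<open>\<phi>\<close>.\<close>

definition bounded_form :: "fm \<Rightarrow> fm \<Rightarrow> bool" where
  "bounded_form \<beta> \<phi> \<longleftrightarrow> is_Delta0 \<beta> \<and> (\<forall>e b. sat (case_nat b e) \<beta> \<longrightarrow> sat e \<phi>) \<and>
    (\<forall>(M :: nat arith) e. PA_model M \<longrightarrow> msat M e \<phi> \<longrightarrow>
      PA_model.eventually_large M (\<lambda>b. msat M (case_nat b e) \<beta>))"

definition swap01 :: "fm \<Rightarrow> fm" where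
  "swap01 = subst (case_nat (Var 1) (case_nat (Var 0) (\<lambda>n. Var (n + 2))))"

lemma msat_swap01 [simp]:
  "msat M (case_nat x (case_nat y e)) (swap01 \<phi>) \<longleftrightarrow> msat M (case_nat y (case_nat x e)) \<phi>"
  by (simp add: swap01_def teval_case_nat)

lemma sat_swap01 [simp]:
  "sat (case_nat x (case_nat y e)) (swap01 \<phi>) \<longleftrightarrow> sat (case_nat y (case_nat x e)) \<phi>"
  unfolding msat_standard[symmetric] by (rule msat_swap01)

text \<open>One bound controls all existential quantifiers: any \<open>b\<close> beyond a chosen
  witness \<open>x\<close> and large enough for the body at \<open>x\<close> will do.\<close>

lemma bounded_form_exists: "Sigma_class \<phi> \<Longrightarrow> \<exists>\<beta>. bounded_form \<beta> \<phi>"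
proof (induction rule: Sigma_class.induct)
  case (Delta0 \<phi>)
  then have "is_Delta0 (lift \<phi>)" by (simp add: lift_def Delta0_subst)
  then have "bounded_form (lift \<phi>) \<phi>"
    by (simp add: bounded_form_def PA_model.eventually_large_all)
  then show ?case by blast
next
  case (Conj \<phi> \<psi>)
  then obtain \<beta> \<gamma> where "bounded_form \<beta> \<phi>" "bounded_form \<gamma> \<psi>" by blast
  then have "bounded_form (Conj \<beta> \<gamma>) (Conj \<phi> \<psi>)"
    unfolding bounded_form_def
    by (auto intro: is_Delta0.intros PA_model.eventually_large_conj)
  then show ?case by blast
next
  case (Disj \<phi> \<psi>)
  then obtain \<beta> \<gamma> where "bounded_form \<beta> \<phi>" "bounded_form \<gamma> \<psi>" by blast
  then have "bounded_form (Disj \<beta> \<gamma>) (Disj \<phi> \<psi>)"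
    unfolding bounded_form_def
    by (auto intro: is_Delta0.intros intro!: PA_model.eventually_large_disj)
  then show ?case by blast
next
  case (Exists \<phi>)
  then obtain \<beta> where \<beta>: "bounded_form \<beta> \<phi>" by blast
  \<comment> \<open>Inside the bounded quantifier the witness is index 0 and the bound index 1,
    whereas \<open>\<beta>\<close> expects the bound at index 0.\<close>
  let ?\<gamma> = "bex_fm (Var 0) (swap01 \<beta>)"
  have "is_Delta0 (swap01 \<beta>)"
    using \<beta> by (simp add: bounded_form_def swap01_def Delta0_subst)
  then have "is_Delta0 ?\<gamma>" by (rule is_Delta0.intros)
  moreover have "sat e (Exists \<phi>)" if "sat (case_nat b e) ?\<gamma>" for e b
    using that \<beta> by (auto simp: bounded_form_def)
  moreover have "PA_model.eventually_large M (\<lambda>b. msat M (case_nat b e) ?\<gamma>)"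
    if M: "PA_model M" and "msat M e (Exists \<phi>)" for M :: "nat arith" and e
  proof -
    interpret PA_model M by fact
    obtain x where "msat M (case_nat x e) \<phi>" using \<open>msat M e (Exists \<phi>)\<close> by auto
    then have "eventually_large (\<lambda>b. msat M (case_nat b (case_nat x e)) \<beta>)"
      using \<beta> M by (auto simp: bounded_form_def)
    from eventually_large_conj[OF eventually_large_lt[of x] this]
    show ?thesis by (rule eventually_large_mono) auto
  qed
  ultimately have "bounded_form ?\<gamma> (Exists \<phi>)" by (auto simp: bounded_form_def)
  then show ?case by blast
qed


section \<open>Making a relation single-valued\<close>

text \<open>With \<open>y\<close> at index 0, this says that for the least \<open>b\<close> such that
  \<open>\<beta>(b, y')\<close> for some \<open>y' < b\<close>, the least solution of \<open>\<beta>(b, -)\<close> is \<open>y\<close>.\<close>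

definition least_solution :: "fm \<Rightarrow> fm" where
  "least_solution \<beta> =
    (let \<gamma> = bex_fm (Var 0) (swap01 \<beta>) in
      Exists (Conj (rename1 \<gamma>)
        (Conj (ball_fm (Var 0) (Neg (subst (case_nat (Var 0) (\<lambda>n. Var (n + 3))) \<gamma>)))
        (Conj \<beta>
          (ball_fm (Var 1) (Neg (subst (case_nat (Var 1) (case_nat (Var 0) (\<lambda>n. Var (n + 3)))) \<beta>)))))))"

lemma msat_least_solution:
  "msat M (case_nat y e) (least_solution \<beta>) \<longleftrightarrow>
    (\<exists>b. (\<exists>z. lss M z b \<and> msat M (case_nat b (case_nat z e)) \<beta>) \<and>
      (\<forall>b'. lss M b' b \<longrightarrow> \<not> (\<exists>z. lss M z b' \<and> msat M (case_nat b' (case_nat z e)) \<beta>)) \<and>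
      msat M (case_nat b (case_nat y e)) \<beta> \<and>
      (\<forall>z. lss M z y \<longrightarrow> \<not> msat M (case_nat b (case_nat z e)) \<beta>))"
  by (simp add: least_solution_def Let_def teval_case_nat teval_up eval_nat_numeral)

lemma least_solution_Sigma1: "is_Delta0 \<beta> \<Longrightarrow> is_Sigma 1 (least_solution \<beta>)"
proof -
  assume \<beta>: "is_Delta0 \<beta>"
  have "is_Delta0 (swap01 \<beta>)" by (simp add: swap01_def Delta0_subst \<beta>)
  then have \<gamma>: "is_Delta0 (bex_fm (Var 0) (swap01 \<beta>))" by (rule is_Delta0.intros)
  let ?\<delta> = "Conj (rename1 (bex_fm (Var 0) (swap01 \<beta>)))
    (Conj (ball_fm (Var 0) (Neg (subst (case_nat (Var 0) (\<lambda>n. Var (n + 3)))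
        (bex_fm (Var 0) (swap01 \<beta>)))))
    (Conj \<beta> (ball_fm (Var 1)
      (Neg (subst (case_nat (Var 1) (case_nat (Var 0) (\<lambda>n. Var (n + 3)))) \<beta>)))))"
  have "is_Delta0 ?\<delta>"
    unfolding rename1_def by (intro is_Delta0.intros Delta0_subst \<beta> \<gamma>)
  then show ?thesis by (simp add: least_solution_def Let_def)
qed

text \<open>The least number principle, applied first to \<open>b\<close> and then to
  \<open>y\<close>, gives existence; linearity of the order gives uniqueness.\<close>

lemma (in PA_model) least_solution_unique:
  assumes "eventually_large (\<lambda>b. msat M (case_nat b (case_nat y e)) \<beta>)"
  shows "\<exists>!y. msat M (case_nat y e) (least_solution \<beta>)"
proof -
  let ?\<gamma> = "bex_fm (Var 0) (swap01 \<beta>)"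
  \<comment> \<open>The search for \<open>b\<close> looks only at solutions below \<open>b\<close>,
    which keeps its condition bounded; a large \<open>b\<close> exceeds the given
    \<open>y\<close>.\<close>
  obtain b where "lt y b" "msat M (case_nat b (case_nat y e)) \<beta>"
    using eventually_large_ex[OF eventually_large_conj[OF eventually_large_lt[of y] assms]] by auto
  then have "msat M (case_nat b e) ?\<gamma>" by auto
  from least_element[OF this] obtain b where
    b: "\<exists>z. lt z b \<and> msat M (case_nat b (case_nat z e)) \<beta>"
      "\<forall>b'. lt b' b \<longrightarrow> \<not> (\<exists>z. lt z b' \<and> msat M (case_nat b' (case_nat z e)) \<beta>)"
    by auto
  then obtain z where "msat M (case_nat z (case_nat b e)) (swap01 \<beta>)" by auto
  from least_element[OF this] obtain y where
    y: "msat M (case_nat b (case_nat y e)) \<beta>"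
      "\<forall>z. lt z y \<longrightarrow> \<not> msat M (case_nat b (case_nat z e)) \<beta>"
    by auto
  show ?thesis
  proof (rule ex1I)
    show "msat M (case_nat y e) (least_solution \<beta>)"
      unfolding msat_least_solution using b y by blast
  next
    fix y' assume "msat M (case_nat y' e) (least_solution \<beta>)"
    then obtain b' where
      b': "\<exists>z. lt z b' \<and> msat M (case_nat b' (case_nat z e)) \<beta>"
      "\<forall>b''. lt b'' b' \<longrightarrow> \<not> (\<exists>z. lt z b'' \<and> msat M (case_nat b'' (case_nat z e)) \<beta>)"
      and y': "msat M (case_nat b' (case_nat y' e)) \<beta>"
      "\<forall>z. lt z y' \<longrightarrow> \<not> msat M (case_nat b' (case_nat z e)) \<beta>"
      unfolding msat_least_solution by blast
    have "b' = b" using b b' lt_linear by blast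
    then show "y' = y" using y y' lt_linear by blast
  qed
qed


section \<open>Failure of a basis instance as an existential statement\<close>

definition numeral_tm :: "nat \<Rightarrow> tm" where
  "numeral_tm n = (Sc ^^ n) Zero"

definition num_val :: "'a arith \<Rightarrow> nat \<Rightarrow> 'a" where
  "num_val M n = (suc M ^^ n) (zer M)"

lemma teval_numeral_tm [simp]: "teval M e (numeral_tm n) = num_val M n"
  by (induction n) (auto simp: numeral_tm_def num_val_def)

definition conj_list :: "fm list \<Rightarrow> fm" where
  "conj_list \<phi>s = foldr Conj \<phi>s (Neg Falsum)"

definition disj_list :: "fm list \<Rightarrow> fm" where
  "disj_list \<phi>s = foldr Disj \<phi>s Falsum"

lemma msat_conj_list [simp]: "msat M e (conj_list \<phi>s) \<longleftrightarrow> (\<forall>\<phi>\<in>set \<phi>s. msat M e \<phi>)"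
  by (induction \<phi>s) (auto simp: conj_list_def)

lemma msat_disj_list [simp]: "msat M e (disj_list \<phi>s) \<longleftrightarrow> (\<exists>\<phi>\<in>set \<phi>s. msat M e \<phi>)"
  by (induction \<phi>s) (auto simp: disj_list_def)

lemma Sigma_class_conj_list: "(\<And>\<phi>. \<phi> \<in> set \<phi>s \<Longrightarrow> Sigma_class \<phi>) \<Longrightarrow> Sigma_class (conj_list \<phi>s)"
  by (induction \<phi>s) (auto simp: conj_list_def intro: Sigma_class.intros is_Delta0.intros)

lemma Sigma_class_disj_list: "(\<And>\<phi>. \<phi> \<in> set \<phi>s \<Longrightarrow> Sigma_class \<phi>) \<Longrightarrow> Sigma_class (disj_list \<phi>s)"
  by (induction \<phi>s) (auto simp: disj_list_def intro: Sigma_class.intros is_Delta0.intros)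

text \<open>The arithmetized notions become relations on the elements of any structure. What matters
  below is that they depend only on the values of the terms, so no law of arithmetic enters.\<close>

definition mmem :: "'a arith \<Rightarrow> 'a \<Rightarrow> 'a \<Rightarrow> bool" where
  "mmem M x a \<longleftrightarrow> msat M (case_nat x (\<lambda>_. a)) (mem_fm (Var 0) (Var 1))"

lemma msat_mem_fm [simp]: "msat M e (mem_fm s t) \<longleftrightarrow> mmem M (teval M e s) (teval M e t)"
  by (simp add: mmem_def mem_fm_def pair_tm_def eval_nat_numeral)

definition mpair :: "'a arith \<Rightarrow> 'a \<Rightarrow> 'a \<Rightarrow> 'a" where
  "mpair M x y = pls M (tms M (pls M x y) (pls M x y)) x"

lemma teval_pair_tm [simp]: "teval M e (pair_tm s t) = mpair M (teval M e s) (teval M e t)"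
  by (simp add: pair_tm_def mpair_def)

definition mtable :: "'a arith \<Rightarrow> 'a \<Rightarrow> 'a \<Rightarrow> 'a \<Rightarrow> bool" where
  "mtable M w s t \<longleftrightarrow>
    msat M (case_nat w (case_nat s (\<lambda>_. t))) (table_fm (Var 0) (Var 1) (Var 2))"

lemma msat_table_fm [simp]:
  "msat M e (table_fm w s t) \<longleftrightarrow> mtable M (teval M e w) (teval M e s) (teval M e t)"
  by (simp add: mtable_def table_fm_def node_tm_def eval_nat_numeral)

text \<open>The closure condition of \<open>tree_fm\<close> on the element at index 0 of the set at index 1.\<close>

definition closed_fm :: fm where
  "closed_fm = Disj (Equal (Var 0) Zero)
    (bex_fm (Var 0) (bex_fm (Var 1)
      (Conj (Equal (Var 2) (node_tm (Var 1) (Var 0)))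
        (Conj (mem_fm (Var 1) (Var 3)) (mem_fm (Var 0) (Var 3))))))"

definition mclosed :: "'a arith \<Rightarrow> 'a \<Rightarrow> 'a \<Rightarrow> bool" where
  "mclosed M x u \<longleftrightarrow> msat M (case_nat x (\<lambda>_. u)) closed_fm"

lemma msat_closed_fm [simp]: "msat M (case_nat x (case_nat u e)) closed_fm \<longleftrightarrow> mclosed M x u"
  by (simp add: mclosed_def closed_fm_def node_tm_def eval_nat_numeral)

definition mtree :: "'a arith \<Rightarrow> 'a \<Rightarrow> bool" where
  "mtree M t \<longleftrightarrow> (\<exists>u. mmem M t u \<and> (\<forall>x. mmem M x u \<longrightarrow> mclosed M x u))"

lemma msat_tree_fm [simp]: "msat M e (tree_fm t) \<longleftrightarrow> mtree M (teval M e t)"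
  unfolding tree_fm_def closed_fm_def[symmetric] by (simp add: mtree_def)

definition mle :: "'a arith \<Rightarrow> 'a \<Rightarrow> 'a \<Rightarrow> bool" where
  "mle M s t \<longleftrightarrow> (\<forall>w. mtable M w s t \<longrightarrow> mmem M (mpair M s t) w)"

lemma msat_le_fm [simp]: "msat M e (le_fm s t) \<longleftrightarrow> mle M (teval M e s) (teval M e t)"
  by (simp add: le_fm_def mle_def)

lemma msat_basis_fm:
  "msat M e (basis_fm \<phi>) \<longleftrightarrow>
    (\<exists>a. (\<forall>x. mmem M x a \<longrightarrow> mtree M x \<and> msat M (case_nat x e) \<phi>) \<and>
      (\<forall>t. mtree M t \<longrightarrow> msat M (case_nat t e) \<phi> \<longrightarrow> (\<exists>x. mmem M x a \<and> mle M x t)))"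
  by (auto simp: basis_fm_def treeset_fm_def eval_nat_numeral)

lemma Delta0_mem_fm: "is_Delta0 (mem_fm s t)"
  unfolding mem_fm_def by (intro is_Delta0.intros)

lemma Delta0_table_fm: "is_Delta0 (table_fm w s t)"
  unfolding table_fm_def by (intro is_Delta0.intros Delta0_mem_fm)

lemma Delta0_closed_fm: "is_Delta0 closed_fm"
  unfolding closed_fm_def by (intro is_Delta0.intros Delta0_mem_fm)

lemma mem_decode_set_le: "x \<in> decode_set a \<Longrightarrow> x \<le> a"
  using pair_ge1 unfolding decode_set_def by (auto intro: order.strict_implies_order less_le_trans)

text \<open>\<open>a\<close> codes the set \<open>ss\<close>; for \<open>s\<close> in \<open>ss\<close>, \<open>u s\<close> witnesses that \<open>s\<close> codes a tree and \<open>v s\<close>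
  witnesses the formula \<open>Exists \<delta>\<close>.\<close>

definition wrong_element :: "fm \<Rightarrow> nat \<Rightarrow> nat \<Rightarrow> nat \<Rightarrow> nat \<Rightarrow> fm" where
  "wrong_element \<delta> a s u v =
    Disj (Neg (mem_fm (numeral_tm s) (numeral_tm a)))
    (Disj (Neg (mem_fm (numeral_tm s) (numeral_tm u)))
    (Disj (Exists (Conj (Equal (Var 0) (numeral_tm u))
        (Exists (Conj (mem_fm (Var 0) (Var 1)) (Neg closed_fm)))))
      (Neg (subst (case_nat (numeral_tm v) (case_nat (numeral_tm s) Var)) \<delta>))))"

text \<open>In an arbitrary structure the element denoted by the numeral of \<open>a\<close> can
  have members outside the list, so this counts as one way to fail.\<close>

definition other_element :: "nat \<Rightarrow> nat list \<Rightarrow> fm" where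
  "other_element a ss = Exists (Conj (mem_fm (Var 0) (numeral_tm a))
    (conj_list (map (\<lambda>s. Neg (Equal (Var 0) (numeral_tm s))) ss)))"

text \<open>The bound on the elements of the witness for \<open>t\<close> being a tree is harmless, but the
  quantifier has to be bounded to stay in the class. The negated order relation is existential.\<close>

definition uncovered :: "fm \<Rightarrow> nat list \<Rightarrow> fm" where
  "uncovered \<delta> ss = Exists (Conj
    (Exists (Conj (mem_fm (Var 1) (Var 0))
      (ball_fm (Sc (Var 0)) (Imp (mem_fm (Var 0) (Var 1)) closed_fm))))
    (Conj (Exists \<delta>)
      (conj_list (map (\<lambda>s. Exists (Conj (table_fm (Var 0) (numeral_tm s) (Var 1))
        (Neg (mem_fm (pair_tm (numeral_tm s) (Var 1)) (Var 0))))) ss))))"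

definition basis_failure :: "fm \<Rightarrow> nat \<Rightarrow> nat list \<Rightarrow> (nat \<Rightarrow> nat) \<Rightarrow> (nat \<Rightarrow> nat) \<Rightarrow> fm" where
  "basis_failure \<delta> a ss u v = Disj (other_element a ss) (Disj (uncovered \<delta> ss)
    (disj_list (map (\<lambda>s. wrong_element \<delta> a s (u s) (v s)) ss)))"

text \<open>Negation falls on bounded formulas only: the closure condition is bounded once its set
  is given, and failure of the order is witnessed by a table.\<close>

lemma Sigma_class_basis_failure:
  assumes "is_Delta0 \<delta>" shows "Sigma_class (basis_failure \<delta> a ss u v)"
proof -
  have "Sigma_class (other_element a ss)"
    unfolding other_element_def
    by (intro Sigma_class.Exists Sigma_class.Conj Sigma_class_conj_list)
      (auto intro: Sigma_class.intros is_Delta0.intros Delta0_mem_fm)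
  moreover have "Sigma_class (wrong_element \<delta> a s u v)" for s u v
    unfolding wrong_element_def
    by (intro Sigma_class.Exists Sigma_class.Conj Sigma_class.Disj)
      (intro Sigma_class.Delta0 is_Delta0.intros Delta0_mem_fm Delta0_closed_fm Delta0_subst assms)+
  moreover have "Sigma_class (uncovered \<delta> ss)"
  proof -
    have "Sigma_class (ball_fm (Sc (Var 0)) (Imp (mem_fm (Var 0) (Var 1)) closed_fm))"
      by (intro Sigma_class.Delta0 is_Delta0.intros Delta0_mem_fm Delta0_closed_fm)
    moreover
    have "is_Delta0 (Conj (table_fm (Var 0) (numeral_tm s) (Var 1))
        (Neg (mem_fm (pair_tm (numeral_tm s) (Var 1)) (Var 0))))" for s
      by (intro is_Delta0.intros Delta0_mem_fm Delta0_table_fm)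
    then have "Sigma_class (conj_list (map (\<lambda>s. Exists (Conj (table_fm (Var 0) (numeral_tm s) (Var 1))
        (Neg (mem_fm (pair_tm (numeral_tm s) (Var 1)) (Var 0))))) ss))"
      by (intro Sigma_class_conj_list) (auto intro!: Sigma_class.Exists[OF Sigma_class.Delta0])
    ultimately show ?thesis
      unfolding uncovered_def
      by (intro Sigma_class.Exists Sigma_class.Conj Sigma_class.Delta0[OF Delta0_mem_fm]
          Sigma_class.Delta0[OF assms])
  qed
  ultimately show ?thesis
    unfolding basis_failure_def
    by (intro Sigma_class.Disj Sigma_class_disj_list) auto
qed

lemma msat_basis_failure:
  "msat M e (basis_failure \<delta> a ss u v) \<longleftrightarrow>
    (\<exists>x. mmem M x (num_val M a) \<and> (\<forall>s\<in>set ss. x \<noteq> num_val M s)) \<or>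
    (\<exists>t. (\<exists>w. mmem M t w \<and> (\<forall>x. lss M x (suc M w) \<longrightarrow> mmem M x w \<longrightarrow> mclosed M x w)) \<and>
      msat M (case_nat t e) (Exists \<delta>) \<and> (\<forall>s\<in>set ss. \<not> mle M (num_val M s) t)) \<or>
    (\<exists>s\<in>set ss. \<not> mmem M (num_val M s) (num_val M a) \<or> \<not> mmem M (num_val M s) (num_val M (u s)) \<or>
      (\<exists>x. mmem M x (num_val M (u s)) \<and> \<not> mclosed M x (num_val M (u s))) \<or>
      \<not> msat M (case_nat (num_val M (v s)) (case_nat (num_val M s) e)) \<delta>)"
  by (simp add: basis_failure_def other_element_def uncovered_def wrong_element_def mle_def
      teval_case_nat)

text \<open>The numeral of \<open>a\<close> denotes the basis inside \<open>M\<close>: its members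
  are listed numerals, and the numerals given by \<open>u\<close> and \<open>v\<close> witness that
  these are trees with the required property. This is pure logic, valid in every structure.\<close>

lemma basis_failure_complete:
  assumes "\<not> msat M e (basis_failure \<delta> a ss u v)"
  shows "msat M e (basis_fm (Exists \<delta>))"
proof -
  let ?a = "num_val M a"
  have elems: "\<exists>s\<in>set ss. x = num_val M s" if "mmem M x ?a" for x
    using assms that unfolding msat_basis_failure by blast
  have right: "mmem M (num_val M s) ?a" "mtree M (num_val M s)"
      "msat M (case_nat (num_val M s) e) (Exists \<delta>)" if "s \<in> set ss" for s
    using assms that unfolding msat_basis_failure mtree_def msat.simps(8) by meson+
  have "mtree M x \<and> msat M (case_nat x e) (Exists \<delta>)" if "mmem M x ?a" for x
    using elems[OF that] right by blast
  moreover have "\<exists>x. mmem M x ?a \<and> mle M x t"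
    if "mtree M t" "msat M (case_nat t e) (Exists \<delta>)" for t
  proof -
    \<comment> \<open>A witness for \<open>mtree\<close> also passes the bounded closure test of
      \<open>uncovered\<close>, so the failure of that disjunct applies to \<open>t\<close>.\<close>
    obtain s where "s \<in> set ss" "mle M (num_val M s) t"
      using assms \<open>mtree M t\<close> \<open>msat M (case_nat t e) (Exists \<delta>)\<close>
      unfolding msat_basis_failure mtree_def by meson
    then show ?thesis using right by blast
  qed
  ultimately show ?thesis unfolding msat_basis_fm by blast
qed

text \<open>Kruskal's theorem enters here through \<open>finite_basis\<close>: the instance is true
  in the standard model, and the parameters are read off a true basis.\<close>

lemma basis_failure_false:
  obtains a ss u v where "\<not> sat e (basis_failure \<delta> a ss u v)"
proof -
  let ?N = standard
  have num [simp]: "num_val ?N n = n" for n by (induction n) (auto simp: num_val_def)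
  have "mmem ?N x w \<longleftrightarrow> x \<in> decode_set w" for x w
    using msat_mem_fm[of ?N "case_nat x (\<lambda>_. w)" "Var 0" "Var 1"] unfolding msat_standard by simp
  note mem = this
  obtain A where A: "A \<subseteq> {t. sat (case_nat (code t) e) (Exists \<delta>)}" "finite A"
      "\<forall>t\<in>{t. sat (case_nat (code t) e) (Exists \<delta>)}. \<exists>s\<in>A. btree_le s t"
    using finite_basis by meson
  then have "sat e (basis_fm (Exists \<delta>))"
    unfolding sat_basis_fm by blast
  then obtain a where
    a: "\<forall>x. mmem ?N x a \<longrightarrow> mtree ?N x \<and> msat ?N (case_nat x e) (Exists \<delta>)"
      "\<forall>t. mtree ?N t \<longrightarrow> msat ?N (case_nat t e) (Exists \<delta>) \<longrightarrow> (\<exists>x. mmem ?N x a \<and> mle ?N x t)"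
    unfolding msat_standard[symmetric] msat_basis_fm by blast
  obtain ss where ss: "set ss = decode_set a" using finite_list[OF finite_decode_set] by blast
  have "\<forall>s. \<exists>u. s \<in> set ss \<longrightarrow> mmem ?N s u \<and> (\<forall>x. mmem ?N x u \<longrightarrow> mclosed ?N x u)"
    using a(1) unfolding ss mem mtree_def by blast
  then obtain u where
    u: "\<And>s. s \<in> set ss \<Longrightarrow> mmem ?N s (u s) \<and> (\<forall>x. mmem ?N x (u s) \<longrightarrow> mclosed ?N x (u s))"
    by metis
  have "\<forall>s. \<exists>v. s \<in> set ss \<longrightarrow> msat ?N (case_nat v (case_nat s e)) \<delta>"
    using a(1) unfolding ss mem by auto
  then obtain v where v: "\<And>s. s \<in> set ss \<Longrightarrow> msat ?N (case_nat (v s) (case_nat s e)) \<delta>"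
    by metis
  \<comment> \<open>Standard members of a coded set are at most its code, so the bounded closure
    test is the full one.\<close>
  have tree: "mtree ?N t"
    if "mmem ?N t w" "\<forall>x. x < Suc w \<longrightarrow> mmem ?N x w \<longrightarrow> mclosed ?N x w" for t w
    using that mem_decode_set_le unfolding mtree_def mem less_Suc_eq_le by blast
  have "\<not> msat ?N e (basis_failure \<delta> a ss u v)"
    unfolding msat_basis_failure num standard_simps using u v a(2) tree ss mem by blast
  then show thesis using that by (simp add: msat_standard)
qed


section \<open>Provably total functions\<close>

text \<open>The failure formulas of the instances are collected by disjunction, starting from
  \<open>Falsum\<close>.\<close>

lemma finite_scheme_failure:
  assumes "finite F" "F \<subseteq> K_Sigma1_minus"
  obtains \<nu> where "Sigma_class \<nu>" "\<not> sat (\<lambda>_. 0) \<nu>"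
    "\<And>(M :: nat arith) e. \<not> msat M e \<nu> \<Longrightarrow> \<forall>\<kappa>\<in>F. msat M e \<kappa>"
proof -
  have "\<exists>\<nu>. Sigma_class \<nu> \<and> \<not> sat (\<lambda>_. 0) \<nu> \<and>
      (\<forall>(M :: nat arith) e. \<not> msat M e \<nu> \<longrightarrow> (\<forall>\<kappa>\<in>F. msat M e \<kappa>))"
    using assms
  proof (induction F)
    case empty
    then show ?case by (intro exI[of _ Falsum]) (auto intro: Delta0 is_Delta0.intros)
  next
    case (insert \<kappa> F)
    then obtain \<nu> where \<nu>: "Sigma_class \<nu>" "\<not> sat (\<lambda>_. 0) \<nu>"
        "\<forall>(M :: nat arith) e. \<not> msat M e \<nu> \<longrightarrow> (\<forall>\<kappa>\<in>F. msat M e \<kappa>)" by auto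
    obtain \<delta> where \<delta>: "\<kappa> = basis_fm (Exists \<delta>)" "is_Delta0 \<delta>"
      using insert.prems by (auto simp: K_Sigma1_minus_def)
    obtain a ss u v where "\<not> sat (\<lambda>_. 0) (basis_failure \<delta> a ss u v)"
      by (rule basis_failure_false)
    then show ?case
      using \<nu> \<delta> Sigma_class_basis_failure basis_failure_complete
      by (intro exI[of _ "Disj \<nu> (basis_failure \<delta> a ss u v)"]) (auto intro: Sigma_class.Disj)
  qed
  then show thesis using that by blast
qed

lemma provably_total_conservative:
  assumes "provably_total (PA \<union> K_Sigma1_minus) f"
  shows "provably_total PA f"
proof -
  obtain \<phi> where "computable f" and \<phi>: "is_Sigma 1 \<phi>" "\<And>e. sat e \<phi> \<longleftrightarrow> f (e 1) = e 0"
    and prv: "PA \<union> K_Sigma1_minus \<turnstile> Forall (Exists1 \<phi>)"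
    using assms unfolding provably_total_def by blast
  obtain \<Delta> where \<Delta>: "\<Delta> \<subseteq> PA \<union> K_Sigma1_minus" "finite \<Delta>" "\<Delta> \<turnstile> Forall (Exists1 \<phi>)"
    using finite_support[OF prv] by blast
  obtain \<nu> where \<nu>: "Sigma_class \<nu>" "\<not> sat (\<lambda>_. 0) \<nu>"
      "\<And>(M :: nat arith) e. \<not> msat M e \<nu> \<Longrightarrow> \<forall>\<kappa>\<in>\<Delta> - PA. msat M e \<kappa>"
    using finite_scheme_failure[of "\<Delta> - PA"] \<Delta> by blast
  \<comment> \<open>The double lift moves \<open>\<nu>\<close> past the variables \<open>y\<close>
    and \<open>x\<close>, so that its truth does not depend on them.\<close>
  let ?\<psi> = "Disj \<phi> (lift (lift \<nu>))"
  have "Sigma_class \<phi>" using \<phi>(1) by (auto intro: Sigma_class.intros)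
  then have "Sigma_class ?\<psi>"
    unfolding lift_def by (intro Sigma_class.Disj Sigma_class_subst \<nu>)
  then obtain \<beta> where \<beta>: "bounded_form \<beta> ?\<psi>" using bounded_form_exists by blast
  \<comment> \<open>The construction does not control the free variables of \<open>\<beta>\<close>;
    setting all indices above 1 to \<open>Zero\<close> leaves a formula in \<open>x\<close> and
    \<open>y\<close> alone. For this reason \<open>\<nu>\<close> is refuted in the environment that
    is constantly zero.\<close>
  define \<theta> where "\<theta> = subst (\<lambda>n. if n < 2 then Var n else Zero) (least_solution \<beta>)"
  have msat_\<theta>: "msat M (case_nat y (case_nat x e)) \<theta> \<longleftrightarrow>
      msat M (case_nat y (case_nat x (\<lambda>_. zer M))) (least_solution \<beta>)" for M :: "nat arith" and x y e
  proof -
    have "(\<lambda>n. teval M (case_nat y (case_nat x e)) (if n < 2 then Var n else Zero)) =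
        case_nat y (case_nat x (\<lambda>_. zer M))"
      by (auto simp: fun_eq_iff less_Suc_eq split: nat.split)
    then show ?thesis by (simp add: \<theta>_def)
  qed
  have unique: "\<exists>!y. msat M (case_nat y (case_nat x e)) \<theta>"
    if M: "PA_model M" and ex: "\<exists>y. msat M (case_nat y (case_nat x (\<lambda>_. zer M))) ?\<psi>"
    for M :: "nat arith" and x e
    unfolding msat_\<theta> using PA_model.least_solution_unique[OF M] \<beta> M ex
    unfolding bounded_form_def by blast
  have graph: "sat e \<theta> \<longleftrightarrow> f (e 1) = e 0" for e
  proof -
    let ?e = "\<lambda>y. case_nat y (case_nat (e 1) (\<lambda>n. e (n + 2)))"
    have e: "?e (e 0) = e" by (auto simp: fun_eq_iff split: nat.split)
    \<comment> \<open>A solution comes with a bound at which \<open>\<beta>\<close> is true, hence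
      satisfies the disjunction \<open>?\<psi>\<close>; as \<open>\<nu>\<close> is false, it
      satisfies \<open>\<phi>\<close>.\<close>
    have sound: "f (e 1) = y" if "sat (?e y) \<theta>" for y
    proof -
      have "\<exists>b. sat (case_nat b (case_nat y (case_nat (e 1) (\<lambda>_. 0)))) \<beta>"
        using that msat_\<theta>[of standard] unfolding msat_least_solution msat_standard by auto
      then have "sat (case_nat y (case_nat (e 1) (\<lambda>_. 0))) ?\<psi>"
        using \<beta> by (auto simp: bounded_form_def)
      then show ?thesis using \<phi>(2) \<nu>(2) by simp
    qed
    \<comment> \<open>For the converse, some solution exists and \<open>sound\<close> forces it to
      be the value of \<open>f\<close>.\<close>
    have "\<exists>!y. sat (?e y) \<theta>"
      unfolding msat_standard[symmetric]
      by (rule unique[OF PA_model_standard]) (simp add: msat_standard \<phi>(2))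
    then show ?thesis using sound e by metis
  qed
  have fv\<theta>: "fv \<theta> \<subseteq> {0, 1}" by (auto simp: \<theta>_def fv_subst split: if_splits)
  have "PA \<turnstile> Forall (Exists1 \<theta>)"
  proof (rule completeness)
    show "basic_axioms \<subseteq> PA" by (simp add: PA_def)
  next
    fix \<chi> assume "\<chi> \<in> insert (Forall (Exists1 \<theta>)) PA"
    moreover have "fv (Forall (Exists1 \<theta>)) = {}"
      using fv\<theta> by (auto simp: Exists1_def rename1_def fv_subst split: nat.splits)
    ultimately show "fv \<chi> = {}" by (auto simp: PA_def basic_axioms_def)
  next
    fix M :: "nat arith" assume PA: "\<And>\<phi> e. \<phi> \<in> PA \<Longrightarrow> msat M e \<phi>"
    then have M: "PA_model M" by unfold_locales
    let ?e = "\<lambda>_. zer M"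
    \<comment> \<open>If \<open>\<nu>\<close> is true in \<open>M\<close>, any \<open>y\<close> will
      do. Otherwise the finitely many scheme instances in \<open>\<Delta>\<close> hold in
      \<open>M\<close>, and soundness provides a \<open>y\<close> with
      \<open>\<phi>\<close>.\<close>
    have "\<exists>y. msat M (case_nat y (case_nat x ?e)) ?\<psi>" for x
    proof (cases "msat M ?e \<nu>")
      case False
      then have "msat M ?e (Forall (Exists1 \<phi>))"
        using PA \<nu>(3) by (intro model_soundness[OF \<Delta>(3)]) blast
      then show ?thesis by (auto simp: msat_Exists1)
    qed simp
    then show "\<exists>e. msat M e (Forall (Exists1 \<theta>))"
      using unique[OF M] by (auto simp: msat_Exists1)
  qed
  moreover have "is_Sigma 1 \<theta>"
    using least_solution_Sigma1[of \<beta>] \<beta> by (auto simp: \<theta>_def bounded_form_def Delta0_subst)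
  ultimately show ?thesis
    unfolding provably_total_def using \<open>computable f\<close> fv\<theta> graph by blast
qed

theorem proposition3p2:
  shows "{f. provably_total (PA \<union> K_Sigma1_minus) f} = {f. provably_total PA f}"
proof -
  have "provably_total (PA \<union> K_Sigma1_minus) f" if "provably_total PA f" for f
    using that weakening[of PA _ "PA \<union> K_Sigma1_minus"] unfolding provably_total_def by blast
  then show ?thesis using provably_total_conservative by blast
qed

end
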